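(* Let $\varphi$ be a non-constant entire function of exponential type and let $T=\varphi(D):H(\mathbb{C})\to H(\mathbb{C})$ be the associated differential operator. Then there exist a function $f\in H(\mathbb{C})$ and nonzero complex numbers $a_1,a_2,a_3,\ldots$ such that $f$ is hypercyclic for $T$ and $$f(z)=\prod_{j=1}^{\infty}\left(1-\frac{z}{a_j}\right).$$
   Context: $H(\mathbb{C})$ is the Fréchet space of entire functions with the compact-open topology (uniform convergence on compact subsets of $\mathbb{C}$), and $D:f\mapsto f'$ is the differentiation operator. An entire function $\varphi(z)=\sum_{j\ge 0}c_jz^j$ is of exponential type if there are constants $A,B\ge 0$ with $|\varphi(z)|\le Ae^{B|z|}$ for all $z\in\mathbb{C}$; the differential operator $\varphi(D)$ is the continuous linear operator on $H(\mathbb{C})$ given by $\varphi(D)f=\sum_{j\ge 0}c_jD^jf$. A vector $f$ is hypercyclic for $T$ if $\{T^nf: n\ge 1\}$ is dense in $H(\mathbb{C})$. The infinite product denotes the limit in $H(\mathbb{C})$, as $J\to\infty$, of the partial products $\prod_{j=1}^{J}(1-z/a_j)$ taken in the given order. *)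

theory Defs
  imports "HOL-Complex_Analysis.Complex_Analysis"
begin

definition HC :: "(complex \<Rightarrow> complex) topology" where
  "HC = topology_generated_by
     {{f. f holomorphic_on UNIV \<and> f ` K \<subseteq> U} | K U. compact K \<and> open U}"

lemma topspace_HC: "topspace HC = {f. f holomorphic_on UNIV}"
proof -
  have "{f::complex\<Rightarrow>complex. f holomorphic_on UNIV}
      \<in> {{f. f holomorphic_on UNIV \<and> f ` K \<subseteq> U} | K U. compact K \<and> open U}"
    by (auto intro!: exI[of _ "{}"])
  then show ?thesis
    unfolding HC_def topology_generated_by_topspace by blast
qed

lemma HC_nbhd:
  assumes f: "f holomorphic_on UNIV" and K: "compact K" and e: "e > 0"
  shows "\<exists>W. openin HC W \<and> f \<in> W \<and> (\<forall>g\<in>W. \<forall>z\<in>K. dist (g z) (f z) < e)"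
proof -
  have "\<exists>d>0. \<forall>y\<in>cball x d. dist (f y) (f x) < e/2" for x
  proof -
    have "isCont f x"
      using holomorphic_on_imp_continuous_on[OF f] by (simp add: continuous_on_eq_continuous_at)
    then obtain d where d: "d > 0" "\<And>y. dist y x < d \<Longrightarrow> dist (f y) (f x) < e/2"
      using half_gt_zero[OF e] unfolding continuous_at_eps_delta by blast
    show ?thesis
      using d by (intro exI[of _ "d/2"]) (auto simp: dist_commute)
  qed
  then obtain d where d: "\<And>x. d x > 0" "\<And>x y. y \<in> cball x (d x) \<Longrightarrow> dist (f y) (f x) < e/2"
    by metis
  have "K \<subseteq> (\<Union>x\<in>K. ball x (d x))"
    using d(1) by auto
  then obtain C where C: "C \<subseteq> K" "finite C" "K \<subseteq> (\<Union>x\<in>C. ball x (d x))"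
    using compactE_image[OF K, of K "\<lambda>x. ball x (d x)"] by (metis open_ball)
  define B where "B x = {g. g holomorphic_on UNIV \<and> g ` (K \<inter> cball x (d x)) \<subseteq> ball (f x) (e/2)}" for x
  have B: "openin HC (B x)" for x
    unfolding HC_def B_def
    using compact_Int[OF K compact_cball[of x "d x"]] open_ball[of "f x" "e/2"]
    by (intro topology_generated_by_Basis CollectI exI conjI) (rule refl, assumption+)
  define W where "W = topspace HC \<inter> (\<Inter>x\<in>C. B x)"
  have "openin HC W"
    unfolding W_def using C(2)
  proof (induction rule: finite_induct)
    case (insert x F)
    have "topspace HC \<inter> \<Inter> (B ` insert x F) = B x \<inter> (topspace HC \<inter> \<Inter> (B ` F))" by auto
    then show ?case using openin_Int[OF B insert.IH] by simp
  qed simp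
  moreover have "f \<in> W"
  proof -
    have "f y \<in> ball (f x) (e/2)" if "y \<in> cball x (d x)" for x y
      using d(2)[OF that] by (simp add: dist_commute)
    then show ?thesis using f unfolding W_def topspace_HC B_def by blast
  qed
  moreover have "dist (g z) (f z) < e" if gz: "g \<in> W" "z \<in> K" for g z
  proof -
    obtain x where x: "x \<in> C" "z \<in> ball x (d x)" using C gz by blast
    then have "z \<in> K \<inter> cball x (d x)" "g \<in> B x" using gz by (auto simp: W_def)
    then have "g z \<in> ball (f x) (e/2)" "dist (f z) (f x) < e/2"
      using d(2) by (auto simp: B_def image_subset_iff)
    then show ?thesis
      by (metis dist_commute dist_triangle_half_r mem_ball)
  qed
  ultimately show ?thesis by blast
qed

text \<open>The compact-open topology is the topology of uniform convergence on compact sets.\<close>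

lemma openin_HC:
  "openin HC U \<longleftrightarrow> U \<subseteq> {f. f holomorphic_on UNIV} \<and>
     (\<forall>f\<in>U. \<exists>K e. compact K \<and> e > 0 \<and>
        {g. g holomorphic_on UNIV \<and> (\<forall>z\<in>K. dist (g z) (f z) < e)} \<subseteq> U)"
    (is "_ \<longleftrightarrow> _ \<and> ?nb U")
proof (intro iffI conjI)
  assume U: "openin HC U"
  then show "U \<subseteq> {f. f holomorphic_on UNIV}"
    using openin_subset topspace_HC by metis
  from U have "generate_topology_on
     {{f. f holomorphic_on UNIV \<and> f ` K \<subseteq> U} | K U. compact K \<and> open (U::complex set)} U"
    unfolding HC_def openin_topology_generated_by_iff .
  then show "?nb U"
  proof (induction rule: generate_topology_on.induct)
    case Empty
    show ?case by blast
  next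
    case (Int a b)
    show ?case
    proof
      fix f assume "f \<in> a \<inter> b"
      then obtain K e K' e' where
        "compact K" "e > 0" "{g. g holomorphic_on UNIV \<and> (\<forall>z\<in>K. dist (g z) (f z) < e)} \<subseteq> a"
        "compact K'" "e' > 0" "{g. g holomorphic_on UNIV \<and> (\<forall>z\<in>K'. dist (g z) (f z) < e')} \<subseteq> b"
        using Int by (meson IntD1 IntD2)
      then show "\<exists>K e. compact K \<and> e > 0 \<and>
          {g. g holomorphic_on UNIV \<and> (\<forall>z\<in>K. dist (g z) (f z) < e)} \<subseteq> a \<inter> b"
        by (intro exI[of _ "K \<union> K'"] exI[of _ "min e e'"]) (auto simp: subset_iff)
    qed
  next
    case (UN S)
    then show ?case by (meson UnionE Union_upper subset_trans)
  next
    case (Basis s)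
    then obtain K V where s: "s = {f. f holomorphic_on UNIV \<and> f ` K \<subseteq> V}"
      and K: "compact K" and V: "open V" by blast
    show ?case
    proof
      fix f assume f: "f \<in> s"
      have "compact (f ` K)"
      proof (rule compact_continuous_image[OF _ K])
        have "continuous_on UNIV f"
          using f s holomorphic_on_imp_continuous_on by blast
        then show "continuous_on K f" by (rule continuous_on_subset) simp
      qed
      moreover have "f ` K \<inter> - V = {}" using f s by blast
      ultimately obtain e where e: "e > 0" "\<And>x y. x \<in> f ` K \<Longrightarrow> y \<in> - V \<Longrightarrow> e \<le> dist x y"
        using separate_compact_closed[of "f ` K" "- V"] closed_Compl[OF V] by blast
      show "\<exists>K e. compact K \<and> e > 0 \<and>
          {g. g holomorphic_on UNIV \<and> (\<forall>z\<in>K. dist (g z) (f z) < e)} \<subseteq> s"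
      proof (intro exI[of _ K] exI[of _ e] conjI subsetI)
        fix g assume g: "g \<in> {g. g holomorphic_on UNIV \<and> (\<forall>z\<in>K. dist (g z) (f z) < e)}"
        have "g z \<in> V" if "z \<in> K" for z
        proof (rule ccontr)
          assume "g z \<notin> V"
          then have "e \<le> dist (f z) (g z)" using e(2)[of "f z" "g z"] that by simp
          moreover have "dist (g z) (f z) < e" using g that by simp
          ultimately show False by (simp add: dist_commute)
        qed
        then show "g \<in> s" using g unfolding s by blast
      qed (use e K in auto)
    qed
  qed
next
  assume U: "U \<subseteq> {f. f holomorphic_on UNIV} \<and> ?nb U"
  show "openin HC U"
  proof (subst openin_subopen, intro ballI)
    fix f assume f: "f \<in> U"
    then obtain K e where K: "compact K" "e > 0"
      "{g. g holomorphic_on UNIV \<and> (\<forall>z\<in>K. dist (g z) (f z) < e)} \<subseteq> U"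
      using U by blast
    obtain W where W: "openin HC W" "f \<in> W" "\<forall>g\<in>W. \<forall>z\<in>K. dist (g z) (f z) < e"
      using HC_nbhd[of f K e] f U K by blast
    have "W \<subseteq> U"
      using W K(3) openin_subset[OF W(1)] by (auto simp: topspace_HC)
    then show "\<exists>T. openin HC T \<and> f \<in> T \<and> T \<subseteq> U" using W by blast
  qed
qed

lemma limitin_HC:
  "limitin HC s f F \<longleftrightarrow> f holomorphic_on UNIV \<and> (\<forall>\<^sub>F n in F. s n holomorphic_on UNIV) \<and>
     (\<forall>K. compact K \<longrightarrow> uniform_limit K s f F)"
proof (intro iffI conjI allI impI)
  assume L: "limitin HC s f F"
  then show f: "f holomorphic_on UNIV" by (simp add: limitin_def topspace_HC)
  have "\<forall>\<^sub>F n in F. s n \<in> topspace HC"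
    using L limitin_topspace[OF L] unfolding limitin_def by blast
  then show "\<forall>\<^sub>F n in F. s n holomorphic_on UNIV" by (simp add: topspace_HC)
  fix K :: "complex set" assume K: "compact K"
  show "uniform_limit K s f F"
  proof (rule uniform_limitI)
    fix e :: real assume "e > 0"
    then obtain W where W: "openin HC W" "f \<in> W" "\<forall>g\<in>W. \<forall>z\<in>K. dist (g z) (f z) < e"
      using HC_nbhd[OF f K] by blast
    then have "\<forall>\<^sub>F n in F. s n \<in> W" using L by (simp add: limitin_def)
    then show "\<forall>\<^sub>F n in F. \<forall>x\<in>K. dist (s n x) (f x) < e"
      by (rule eventually_mono) (use W in blast)
  qed
next
  assume R: "f holomorphic_on UNIV \<and> (\<forall>\<^sub>F n in F. s n holomorphic_on UNIV) \<and>
     (\<forall>K. compact K \<longrightarrow> uniform_limit K s f F)"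
  show "limitin HC s f F"
    unfolding limitin_def
  proof (intro conjI allI impI)
    show "f \<in> topspace HC" using R by (simp add: topspace_HC)
    fix U assume U: "openin HC U \<and> f \<in> U"
    then obtain K e where K: "compact K" "e > 0"
      "{g. g holomorphic_on UNIV \<and> (\<forall>z\<in>K. dist (g z) (f z) < e)} \<subseteq> U"
      using openin_HC by meson
    then have "\<forall>\<^sub>F n in F. \<forall>z\<in>K. dist (s n z) (f z) < e"
      using R uniform_limitD by blast
    moreover have "\<forall>\<^sub>F n in F. s n holomorphic_on UNIV" using R by blast
    ultimately show "\<forall>\<^sub>F n in F. s n \<in> U"
      by eventually_elim (use K in blast)
  qed
qed

definition exponential_type :: "(complex \<Rightarrow> complex) \<Rightarrow> bool" where
  "exponential_type \<phi> \<longleftrightarrow>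
     (\<exists>A B. A \<ge> 0 \<and> B \<ge> 0 \<and> (\<forall>z. norm (\<phi> z) \<le> A * exp (B * norm z)))"

text \<open>
  For an entire function \<open>\<phi>\<close> of exponential type and an entire function \<open>f\<close> the series below
  converges in \<^const>\<open>HC\<close>, so the pointwise sum used here is the sum of the series of functions.
\<close>

definition diff_op :: "(complex \<Rightarrow> complex) \<Rightarrow> (complex \<Rightarrow> complex) \<Rightarrow> complex \<Rightarrow> complex" where
  "diff_op \<phi> f = (\<lambda>z. \<Sum>j. fps_nth (fps_expansion \<phi> 0) j * (deriv ^^ j) f z)"

definition hypercyclic :: "'a topology \<Rightarrow> ('a \<Rightarrow> 'a) \<Rightarrow> 'a \<Rightarrow> bool" where
  "hypercyclic X T x \<longleftrightarrow>
     x \<in> topspace X \<and> X closure_of {(T ^^ n) x | n. n \<ge> 1} = topspace X"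

end

theory Submission
  imports Defs
begin

text \<open>
  Write \<open>T = \<phi>(D)\<close> and \<open>e\<^sub>l(z) = exp (l * z)\<close>. For a polynomial \<open>p \<noteq> 0\<close> of degree \<open>d\<close>,
  \<open>T\<^sup>n(p e\<^sub>l)\<close> tends to \<open>0\<close> if \<open>|\<phi>(l)| < 1\<close>, while for \<open>|\<phi>(l)| > 1\<close> and \<open>\<phi>'(l) \<noteq> 0\<close> a multiple
  \<open>s\<^sub>n e\<^sub>l\<close> with \<open>s\<^sub>n \<rightarrow> 0\<close> satisfies \<open>T\<^sup>n(p s\<^sub>n e\<^sub>l) \<rightarrow> e\<^sub>l\<close>. As exponentials with \<open>l\<close> in an open set have
  dense span, every partial product \<open>p\<close> admits a polynomial \<open>q\<close> with \<open>q(0) = 1\<close>, close to \<open>1\<close> on a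
  huge disc, such that \<open>T\<^sup>n(p q)\<close> is close to a prescribed target.

  The partial products of the linear factors of \<open>q\<close> need not be close to \<open>1\<close>. Each factor
  \<open>1 - z/b\<close> is therefore followed by linear factors whose product approximates \<open>exp h\<close> for a
  polynomial \<open>h\<close> near \<open>- Ln (1 - z/b)\<close> on the smaller disc, and the total exponential is
  removed at the end; \<open>exp h\<close> is reached in the small steps \<open>(1 + h/N)\<^sup>k\<close>.
  Concatenating such blocks for a dense sequence of targets gives the infinite product.
\<close>

section \<open>Density of spans of exponentials\<close>

text \<open>Closeness of \<open>q\<close> to \<open>1\<close> on a large disc pushes its zeros away
  but does not bound their number; this is why their partial products escape control. The infinite
  product has to converge along all partial products, not only along the ends of blocks, so every
  prefix inside a block must be estimated. A block need only approximate \<open>q\<close>, because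
  \<open>T\<close> is continuous with explicit constants: one application costs a factor
  \<open>2 * A\<close> and \<open>2 * B\<close> of radius. This fixes the order of choices: the
  tolerance for prefixes, the disc on which \<open>q\<close> must be near \<open>1\<close>, then
  \<open>q\<close> together with \<open>n\<close>, and only afterwards the accuracy to which the
  block matches \<open>q\<close>. The same constants say how small all later blocks must be for the
  iterate already arranged to survive. The derivative of \<phi> enters because of the factor
  \<open>p\<close>: on polynomials times an exponential \<open>T\<close> acts as the scalar
  \<phi>(l) plus a nilpotent operator, which lowers degrees by exactly one if the derivative at
  \<open>l\<close> is nonzero.\<close>

lemma polynomial_approximation:
  fixes f :: "complex \<Rightarrow> complex"
  assumes hol: "f holomorphic_on ball 0 r" and R: "R < r" and e: "e > 0"
  obtains p :: "complex poly" where "\<And>z. z \<in> cball 0 R \<Longrightarrow> norm (f z - poly p z) < e"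
proof (cases "R < 0")
  case True
  then show ?thesis using that[of 0] by simp
next
  case False
  define a where "a n = (deriv ^^ n) f 0 / fact n" for n
  have sums: "(\<lambda>n. a n * z ^ n) sums f z" if "z \<in> ball 0 r" for z
    using holomorphic_power_series[OF hol that] by (simp add: a_def)
  \<comment> \<open>Convergence at a point strictly between \<open>R\<close> and \<open>r\<close>
    gives a radius of convergence strictly greater than \<open>R\<close>, as
    \<open>powser_uniform_limit\<close> needs.\<close>
  define t where "t = (R + r) / 2"
  have t: "R < t" "t < r" using R by (auto simp: t_def)
  have "complex_of_real t \<in> ball 0 r" using t False by simp
  then have "summable (\<lambda>n. a n * complex_of_real t ^ n)"
    using sums sums_summable by blast
  then have "conv_radius a \<ge> norm (complex_of_real t)" by (rule conv_radius_geI)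
  moreover have "ereal R < ereal (norm (complex_of_real t))" using t False by simp
  ultimately have "R < conv_radius a" by (meson less_le_trans)
  from powser_uniform_limit[OF this, of 0]
  have "uniform_limit (cball 0 R) (\<lambda>n x. \<Sum>i<n. a i * x ^ i) (\<lambda>x. \<Sum>i. a i * x ^ i) sequentially"
    by simp
  then have "\<forall>\<^sub>F n in sequentially. \<forall>x\<in>cball 0 R.
      dist (\<Sum>i<n. a i * x ^ i) (\<Sum>i. a i * x ^ i) < e"
    using e unfolding uniform_limit_iff by blast
  then obtain n where n: "\<forall>x\<in>cball 0 R. dist (\<Sum>i<n. a i * x ^ i) (\<Sum>i. a i * x ^ i) < e"
    by (auto simp: eventually_sequentially)
  show ?thesis
  proof (rule that[of "\<Sum>i<n. monom (a i) i"])
    fix z :: complex assume z: "z \<in> cball 0 R"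
    then have "z \<in> ball 0 r" using R by auto
    then have "f z = (\<Sum>i. a i * z ^ i)" using sums sums_unique by blast
    then show "norm (f z - poly (\<Sum>i<n. monom (a i) i) z) < e"
      using n z by (simp add: poly_sum poly_monom dist_norm norm_minus_commute)
  qed
qed

lemma entire_bounded_on_cball:
  fixes f :: "complex \<Rightarrow> complex"
  assumes "continuous_on UNIV f"
  obtains M where "M > 0" "\<And>z. norm z \<le> r \<Longrightarrow> norm (f z) \<le> M"
proof -
  have "compact (f ` cball 0 r)"
    using assms by (intro compact_continuous_image) (auto intro: continuous_on_subset)
  then have "bounded (f ` cball 0 r)" by (rule compact_imp_bounded)
  then obtain M where "M > 0" "\<forall>x\<in>f ` cball 0 r. norm x \<le> M" unfolding bounded_pos by blast
  then show ?thesis using that by auto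
qed

text \<open>An inductive set instead of a linear span: decay and growth of iterates are proved by
  its induction, which has only two cases because scalars sit in the generators.\<close>

inductive_set exp_span :: "complex set \<Rightarrow> (complex \<Rightarrow> complex) set" for \<Lambda> where
  single: "l \<in> \<Lambda> \<Longrightarrow> (\<lambda>z. c * exp (l * z)) \<in> exp_span \<Lambda>"
| add: "u \<in> exp_span \<Lambda> \<Longrightarrow> v \<in> exp_span \<Lambda> \<Longrightarrow> (\<lambda>z. u z + v z) \<in> exp_span \<Lambda>"

lemma exp_span_scale: "u \<in> exp_span \<Lambda> \<Longrightarrow> (\<lambda>z. c * u z) \<in> exp_span \<Lambda>"
proof (induction rule: exp_span.induct)
  case (single l c')
  then show ?case using exp_span.single[of l \<Lambda> "c * c'"] by (simp add: mult.assoc)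
next
  case (add u v)
  then show ?case using exp_span.add[of _ \<Lambda>] by (simp add: distrib_left)
qed

lemma exp_span_holomorphic: "u \<in> exp_span \<Lambda> \<Longrightarrow> u holomorphic_on UNIV"
  by (induction rule: exp_span.induct) (auto intro!: holomorphic_intros)

definition approx_on :: "real \<Rightarrow> (complex \<Rightarrow> complex) set \<Rightarrow> (complex \<Rightarrow> complex) \<Rightarrow> bool" where
  "approx_on R V f \<longleftrightarrow> (\<forall>e>0. \<exists>v\<in>V. \<forall>z\<in>cball 0 R. norm (f z - v z) < e)"

text \<open>Applied with \<open>g\<close> a difference quotient in \<open>l\<close>, or a polynomial
  times an exponential, neither of which need lie in the span itself.\<close>

lemma approx_onI_approx:
  assumes "\<And>e. e > 0 \<Longrightarrow> \<exists>g. approx_on R V g \<and> (\<forall>z\<in>cball 0 R. norm (f z - g z) < e)"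
  shows "approx_on R V f"
  unfolding approx_on_def
proof (intro allI impI)
  fix e :: real assume e: "e > 0"
  obtain g where g: "approx_on R V g" "\<forall>z\<in>cball 0 R. norm (f z - g z) < e / 2"
    using assms[of "e/2"] e by auto
  obtain v where v: "v \<in> V" "\<forall>z\<in>cball 0 R. norm (g z - v z) < e / 2"
    using g(1) e unfolding approx_on_def by (meson half_gt_zero)
  have "norm (f z - v z) < e" if "z \<in> cball 0 R" for z
    using norm_triangle_lt[of "f z - g z" "g z - v z" e] g(2) v(2) that by fastforce
  then show "\<exists>v\<in>V. \<forall>z\<in>cball 0 R. norm (f z - v z) < e" using v(1) by blast
qed

lemma approx_on_add:
  assumes "approx_on R (exp_span \<Lambda>) f" "approx_on R (exp_span \<Lambda>) g"
  shows "approx_on R (exp_span \<Lambda>) (\<lambda>z. f z + g z)"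
  unfolding approx_on_def
proof (intro allI impI)
  fix e :: real assume e: "e > 0"
  obtain u where u: "u \<in> exp_span \<Lambda>" "\<forall>z\<in>cball 0 R. norm (f z - u z) < e / 2"
    using assms(1) e unfolding approx_on_def by (meson half_gt_zero)
  obtain v where v: "v \<in> exp_span \<Lambda>" "\<forall>z\<in>cball 0 R. norm (g z - v z) < e / 2"
    using assms(2) e unfolding approx_on_def by (meson half_gt_zero)
  have "norm (f z + g z - (u z + v z)) < e" if "z \<in> cball 0 R" for z
    using norm_triangle_lt[of "f z - u z" "g z - v z" e] u(2) v(2) that
    by (fastforce simp: algebra_simps)
  then show "\<exists>v\<in>exp_span \<Lambda>. \<forall>z\<in>cball 0 R. norm (f z + g z - v z) < e"
    using exp_span.add[OF u(1) v(1)] by (intro bexI[of _ "\<lambda>z. u z + v z"]) auto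
qed

lemma approx_on_scale:
  assumes "approx_on R (exp_span \<Lambda>) f"
  shows "approx_on R (exp_span \<Lambda>) (\<lambda>z. c * f z)"
  unfolding approx_on_def
proof (intro allI impI)
  fix e :: real assume e: "e > 0"
  have e': "e / (norm c + 1) > 0" using e by (simp add: add_nonneg_pos)
  then obtain u where u: "u \<in> exp_span \<Lambda>" "\<forall>z\<in>cball 0 R. norm (f z - u z) < e / (norm c + 1)"
    using assms(1) unfolding approx_on_def by meson
  have "norm (c * f z - c * u z) < e" if "z \<in> cball 0 R" for z
  proof -
    have "norm (c * f z - c * u z) = norm c * norm (f z - u z)"
      by (simp add: norm_mult right_diff_distrib[symmetric])
    also have "\<dots> \<le> norm c * (e / (norm c + 1))"
      using u(2) that by (intro mult_left_mono) (auto intro: less_imp_le)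
    also have "\<dots> < (norm c + 1) * (e / (norm c + 1))"
      using e' by (intro mult_strict_right_mono) auto
    also have "\<dots> = e"
      using norm_ge_zero[of c] by (simp add: add_nonneg_eq_0_iff)
    finally show ?thesis .
  qed
  then show "\<exists>v\<in>exp_span \<Lambda>. \<forall>z\<in>cball 0 R. norm (c * f z - v z) < e"
    using exp_span_scale[OF u(1), of c] by (intro bexI[of _ "\<lambda>z. c * u z"]) auto
qed

lemma norm_exp_sub_le:
  fixes w :: complex
  assumes "norm w \<le> 1"
  shows "norm (exp w - 1 - w) \<le> 3 * norm w ^ 2"
proof -
  have "norm (exp w - 1 - w) \<le> exp (norm w) * norm w ^ 2"
    using Taylor_exp_field[of w 1] by (simp add: algebra_simps power2_eq_square)
  also have "\<dots> \<le> 3 * norm w ^ 2"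
    using assms exp_le by (intro mult_right_mono) (auto intro: order_trans[of _ "exp 1"])
  finally show ?thesis .
qed

text \<open>Differentiating \<open>exp (l * z)\<close> repeatedly in \<open>l\<close> produces the factors \<open>z ^ k\<close>.\<close>

lemma approx_on_power_times_exp:
  assumes "open \<Lambda>" "l \<in> \<Lambda>"
  shows "approx_on R (exp_span \<Lambda>) (\<lambda>z. z ^ k * exp (l * z))"
  using assms(2)
proof (induction k arbitrary: l)
  case 0
  have "(\<lambda>z. 1 * exp (l * z)) \<in> exp_span \<Lambda>" using 0 by (rule exp_span.single)
  then show ?case unfolding approx_on_def by (intro allI impI bexI) auto
next
  case (Suc k)
  define S where "S = \<bar>R\<bar> + 1"
  have S: "S \<ge> 1" by (simp add: S_def)
  define M where "M = S ^ k * exp (norm l * S) * (3 * S ^ 2)"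
  have M: "M > 0" using S by (simp add: M_def)
  obtain d where d: "d > 0" "ball l d \<subseteq> \<Lambda>" using assms(1) Suc.prems openE by blast
  show ?case
  proof (rule approx_onI_approx)
    fix e :: real assume e: "e > 0"
    \<comment> \<open>The three bounds serve \<open>norm (h * z) \<le> 1\<close> in
      \<open>norm_exp_sub_le\<close>, membership of \<open>l + h\<close> in \<Lambda>, and the final
      error \<open>t * M < e\<close>.\<close>
    define t where "t = min (1 / S) (min (d / 2) (e / (2 * M)))"
    have t: "t > 0" "t * S \<le> 1" "t < d" "t * M < e"
    proof -
      show "t > 0" using S d e M by (simp add: t_def)
      have "t \<le> 1 / S" by (simp add: t_def)
      then show "t * S \<le> 1" using S by (simp add: field_simps)
      show "t < d" using d by (auto simp: t_def min_def)
      have "t \<le> e / (2 * M)" by (simp add: t_def)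
      then have "t * M \<le> e / 2" using M by (simp add: field_simps)
      then show "t * M < e" using e by simp
    qed
    define h where "h = complex_of_real t"
    have h: "norm h = t" "h \<noteq> 0" using t by (auto simp: h_def)
    have "l + h \<in> \<Lambda>" using d t h by (auto simp: dist_norm subset_iff)
    \<comment> \<open>The difference quotient in \<open>l\<close> of
      \<open>z ^ k * exp (l * z)\<close>. It uses the induction hypothesis at \<open>l\<close> and
      at \<open>l + h\<close>, hence the arbitrary \<open>l\<close>.\<close>
    define g where "g z = inverse h * (z ^ k * exp ((l + h) * z)) + (- inverse h) * (z ^ k * exp (l * z))" for z
    have "approx_on R (exp_span \<Lambda>) g"
      unfolding g_def using Suc.IH[OF Suc.prems] Suc.IH[OF \<open>l + h \<in> \<Lambda>\<close>]
      by (intro approx_on_add approx_on_scale)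
    moreover have "norm (z ^ Suc k * exp (l * z) - g z) < e" if z: "z \<in> cball 0 R" for z
    proof -
      have zS: "norm z \<le> S" using z by (simp add: S_def)
      have hz: "norm (h * z) \<le> t * S" using zS h t by (simp add: norm_mult)
      have "z ^ Suc k * exp (l * z) - g z = - (inverse h * (z ^ k * exp (l * z) * (exp (h * z) - 1 - h * z)))"
        using h by (simp add: g_def exp_add distrib_right field_simps)
      also have "norm \<dots> = inverse t * (norm z ^ k * norm (exp (l * z)) * norm (exp (h * z) - 1 - h * z))"
        using h t by (simp add: norm_mult norm_inverse norm_power)
      also have "\<dots> \<le> inverse t * (S ^ k * exp (norm l * S) * (3 * (t * S) ^ 2))"
      proof (intro mult_left_mono mult_mono power_mono zS)
        show "norm (exp (l * z)) \<le> exp (norm l * S)"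
          using norm_exp[of "l * z"] zS
          by (meson exp_le_cancel_iff mult_left_mono norm_ge_zero norm_mult_ineq order_trans)
        have "norm (exp (h * z) - 1 - h * z) \<le> 3 * norm (h * z) ^ 2"
          using hz t by (intro norm_exp_sub_le) auto
        also have "\<dots> \<le> 3 * (t * S) ^ 2"
          using hz by (intro mult_left_mono power_mono) auto
        finally show "norm (exp (h * z) - 1 - h * z) \<le> 3 * (t * S) ^ 2" .
      qed (use S t in auto)
      also have "\<dots> = t * M" using t by (simp add: M_def power2_eq_square field_simps)
      also have "\<dots> < e" by (rule t)
      finally show ?thesis .
    qed
    ultimately show "\<exists>g. approx_on R (exp_span \<Lambda>) g \<and> (\<forall>z\<in>cball 0 R. norm (z ^ Suc k * exp (l * z) - g z) < e)"
      by blast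
  qed
qed

text \<open>One point \<open>l\<close> suffices: approximating \<open>f z * exp (- l * z)\<close> by
  a polynomial reduces the claim to the functions \<open>z ^ k * exp (l * z)\<close>.\<close>

lemma exp_span_dense:
  assumes "open \<Lambda>" "\<Lambda> \<noteq> {}" "f holomorphic_on UNIV"
  shows "approx_on R (exp_span \<Lambda>) f"
proof (rule approx_onI_approx)
  fix e :: real assume e: "e > 0"
  obtain l where l: "l \<in> \<Lambda>" using assms by blast
  define B where "B = exp (norm l * \<bar>R\<bar>)"
  have B: "B > 0" by (simp add: B_def)
  have "(\<lambda>z. f z * exp (- l * z)) holomorphic_on ball 0 (R + 1)"
    by (intro holomorphic_intros holomorphic_on_subset[OF assms(3)]) auto
  then obtain p where p: "\<And>z. z \<in> cball 0 R \<Longrightarrow> norm (f z * exp (- l * z) - poly p z) < e / B"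
    using polynomial_approximation[of _ "R + 1" R "e / B"] e B by auto
  have "approx_on R (exp_span \<Lambda>) (\<lambda>z. (\<Sum>i\<le>n. coeff p i * z ^ i) * exp (l * z))" for n
  proof (induction n)
    case 0
    show ?case
      using approx_on_scale[OF approx_on_power_times_exp[OF assms(1) l, of R 0], of "coeff p 0"] by simp
  next
    case (Suc n)
    show ?case
      using approx_on_add[OF Suc approx_on_scale[OF approx_on_power_times_exp[OF assms(1) l, of R "Suc n"]],
          of "coeff p (Suc n)"]
      by (simp add: distrib_right mult.assoc)
  qed
  from this[of "degree p"] have "approx_on R (exp_span \<Lambda>) (\<lambda>z. poly p z * exp (l * z))"
    by (simp add: poly_altdef)
  moreover have "norm (f z - poly p z * exp (l * z)) < e" if z: "z \<in> cball 0 R" for z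
  proof -
    have "f z - poly p z * exp (l * z) = (f z * exp (- l * z) - poly p z) * exp (l * z)"
      by (simp add: algebra_simps exp_add[symmetric])
    also have "norm \<dots> = norm (f z * exp (- l * z) - poly p z) * norm (exp (l * z))"
      by (rule norm_mult)
    also have "\<dots> < e / B * B"
    proof (rule mult_less_le_imp_less)
      show "norm (exp (l * z)) \<le> B" unfolding B_def
        using norm_exp[of "l * z"] z
        by (smt (verit) exp_le_cancel_iff mem_cball_0 mult_left_mono norm_ge_zero norm_mult)
    qed (use p[OF z] in auto)
    finally show ?thesis using B by simp
  qed
  ultimately show "\<exists>g. approx_on R (exp_span \<Lambda>) g \<and> (\<forall>z\<in>cball 0 R. norm (f z - g z) < e)" by blast
qed

section \<open>The differential operator\<close>

text \<open>The form in which exponential type enters the estimates for \<open>T\<close>.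
  \<open>A \<ge> 1\<close> gives \<open>(2 * A) ^ n \<ge> 1\<close>, and \<open>B > 0\<close> makes
  Cauchy circles of radius \<open>2 * B\<close> nondegenerate.\<close>

locale exp_coeffs =
  fixes c :: "nat \<Rightarrow> complex" and A B :: real
  assumes A: "A \<ge> 1" and B: "B > 0"
    and coeff_bound: "\<And>j. norm (c j) \<le> A * B ^ j / fact j"
begin

definition T :: "(complex \<Rightarrow> complex) \<Rightarrow> complex \<Rightarrow> complex" where
  "T f z = (\<Sum>j. c j * (deriv ^^ j) f z)"

text \<open>Cauchy's inequality on the circle of radius \<open>2 * B\<close> about \<open>z\<close>:
  its factorial cancels the one in \<open>coeff_bound\<close>, and twice \<open>B\<close> leaves the
  ratio \<open>1/2\<close>.\<close>

lemma term_bound: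
  assumes hol: "f holomorphic_on UNIV"
    and M: "\<And>z. norm z \<le> R + 2 * B \<Longrightarrow> norm (f z) \<le> M" and z: "norm z \<le> R"
  shows "norm (c j * (deriv ^^ j) f z) \<le> A * M * (1/2) ^ j"
proof -
  have "norm (f w) \<le> M" if "norm (z - w) = 2 * B" for w
    using M[of w] z that norm_triangle_ineq4[of z "z - w"] by simp
  then have "norm ((deriv ^^ j) f z) \<le> fact j * M / (2 * B) ^ j"
    using B by (intro Cauchy_inequality holomorphic_on_subset[OF hol]
        continuous_on_subset[OF holomorphic_on_imp_continuous_on[OF hol]]) auto
  then have "norm (c j) * norm ((deriv ^^ j) f z) \<le> (A * B ^ j / fact j) * (fact j * M / (2 * B) ^ j)"
    using coeff_bound[of j] A B by (intro mult_mono) auto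
  also have "\<dots> = A * M * (1/2) ^ j"
    using B by (simp add: power_mult_distrib power_divide)
  finally show ?thesis by (simp add: norm_mult)
qed

lemma summable_geometric_half: "summable (\<lambda>j. a * (1/2::real) ^ j)"
  by (intro summable_mult summable_geometric) auto

lemma summable_T:
  assumes "f holomorphic_on UNIV"
  shows "summable (\<lambda>j. c j * (deriv ^^ j) f z)"
proof -
  obtain M where "\<And>w. norm w \<le> norm z + 2 * B \<Longrightarrow> norm (f w) \<le> M"
    using entire_bounded_on_cball[OF holomorphic_on_imp_continuous_on[OF assms]] by metis
  then show ?thesis
    by (intro summable_comparison_test'[OF summable_geometric_half[of "A * M"]]
        term_bound[OF assms, of "norm z"]) auto
qed

lemma T_bound:
  assumes hol: "f holomorphic_on UNIV"
    and M: "\<And>z. norm z \<le> R + 2 * B \<Longrightarrow> norm (f z) \<le> M" and z: "norm z \<le> R"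
  shows "norm (T f z) \<le> 2 * A * M"
proof -
  have *: "norm (c j * (deriv ^^ j) f z) \<le> A * M * (1/2) ^ j" for j
    by (rule term_bound[OF assms])
  have "norm (T f z) \<le> (\<Sum>j. A * M * (1/2) ^ j)"
    unfolding T_def by (rule norm_suminf_le[OF * summable_geometric_half])
  also have "\<dots> = 2 * A * M"
    by (subst suminf_mult) (auto simp: suminf_geometric intro!: summable_geometric)
  finally show ?thesis .
qed

lemma T_holomorphic:
  assumes hol: "f holomorphic_on UNIV"
  shows "T f holomorphic_on UNIV"
proof (rule holomorphic_uniform_sequence[where f = "\<lambda>n z. \<Sum>j<n. c j * (deriv ^^ j) f z"])
  show "(\<lambda>z. \<Sum>j<n. c j * (deriv ^^ j) f z) holomorphic_on UNIV" for n
    by (intro holomorphic_intros hol) auto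
  fix x :: complex
  obtain M where M: "\<And>w. norm w \<le> (norm x + 1) + 2 * B \<Longrightarrow> norm (f w) \<le> M"
    using entire_bounded_on_cball[OF holomorphic_on_imp_continuous_on[OF hol]] by metis
  have "norm (c j * (deriv ^^ j) f z) \<le> A * M * (1/2) ^ j" if "z \<in> cball x 1" for j z
  proof (rule term_bound[OF hol M])
    show "norm z \<le> norm x + 1"
      using that norm_triangle_ineq2[of z x] by (simp add: dist_norm norm_minus_commute)
  qed
  then have "uniform_limit (cball x 1) (\<lambda>n z. \<Sum>j<n. c j * (deriv ^^ j) f z) (T f) sequentially"
    unfolding T_def by (intro Weierstrass_m_test[OF _ summable_geometric_half])
  then show "\<exists>d>0. cball x d \<subseteq> UNIV \<and>
      uniform_limit (cball x d) (\<lambda>n z. \<Sum>j<n. c j * (deriv ^^ j) f z) (T f) sequentially"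
    by (intro exI[of _ 1]) auto
qed simp

lemma T_add:
  assumes "f holomorphic_on UNIV" "g holomorphic_on UNIV"
  shows "T (\<lambda>z. f z + g z) = (\<lambda>z. T f z + T g z)"
proof
  fix z
  have "(deriv ^^ j) (\<lambda>z. f z + g z) z = (deriv ^^ j) f z + (deriv ^^ j) g z" for j
    by (rule higher_deriv_add[OF assms]) auto
  then show "T (\<lambda>z. f z + g z) z = T f z + T g z"
    unfolding T_def using suminf_add[OF summable_T[OF assms(1), of z] summable_T[OF assms(2), of z]]
    by (simp add: distrib_left)
qed

lemma T_cmult:
  assumes "f holomorphic_on UNIV"
  shows "T (\<lambda>z. a * f z) = (\<lambda>z. a * T f z)"
proof
  fix z
  have "(deriv ^^ j) (\<lambda>z. a * f z) z = a * (deriv ^^ j) f z" for j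
    by (rule higher_deriv_cmult[OF assms]) auto
  then show "T (\<lambda>z. a * f z) z = a * T f z"
    unfolding T_def using suminf_mult[OF summable_T[OF assms, of z], of a]
    by (simp add: mult.left_commute)
qed

lemma T_pow_holomorphic: "f holomorphic_on UNIV \<Longrightarrow> (T ^^ n) f holomorphic_on UNIV"
  by (induction n) (auto intro: T_holomorphic)

lemma T_pow_add:
  assumes "f holomorphic_on UNIV" "g holomorphic_on UNIV"
  shows "(T ^^ n) (\<lambda>z. f z + g z) = (\<lambda>z. (T ^^ n) f z + (T ^^ n) g z)"
  by (induction n) (simp_all add: T_add T_pow_holomorphic assms)

lemma T_pow_cmult:
  assumes "f holomorphic_on UNIV"
  shows "(T ^^ n) (\<lambda>z. a * f z) = (\<lambda>z. a * (T ^^ n) f z)"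
  by (induction n) (simp_all add: T_cmult T_pow_holomorphic assms)

lemma T_pow_diff:
  assumes "f holomorphic_on UNIV" "g holomorphic_on UNIV"
  shows "(T ^^ n) (\<lambda>z. f z - g z) = (\<lambda>z. (T ^^ n) f z - (T ^^ n) g z)"
  using T_pow_add[OF assms(1), of "\<lambda>z. (-1) * g z" n] T_pow_cmult[OF assms(2), of n "-1"] assms
  by (auto intro: holomorphic_intros)

text \<open>Iterating \<open>T_bound\<close>, with \<open>R\<close> enlarged by \<open>2 * B\<close>
  at each step of the induction. The radii and tolerances in \<open>block_sequence\<close> are
  matched to these constants.\<close>

lemma T_pow_bound:
  assumes hol: "f holomorphic_on UNIV"
    and M: "\<And>z. norm z \<le> R + real n * (2 * B) \<Longrightarrow> norm (f z) \<le> M" and z: "norm z \<le> R"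
  shows "norm ((T ^^ n) f z) \<le> (2 * A) ^ n * M"
  using M z
proof (induction n arbitrary: R M z)
  case (Suc n)
  have "norm ((T ^^ n) f w) \<le> (2 * A) ^ n * M" if "norm w \<le> R + 2 * B" for w
    by (rule Suc.IH[OF Suc.prems(1) that]) (simp add: algebra_simps)
  then show ?case
    using T_bound[OF T_pow_holomorphic[OF hol], of R n "(2 * A) ^ n * M" z] Suc.prems(2)
    by (simp add: mult.assoc)
qed auto

lemma T_pow_diff_bound:
  assumes hol: "f holomorphic_on UNIV" "g holomorphic_on UNIV"
    and M: "\<And>z. norm z \<le> R + real n * (2 * B) \<Longrightarrow> norm (f z - g z) \<le> M" and z: "norm z \<le> R"
  shows "norm ((T ^^ n) f z - (T ^^ n) g z) \<le> (2 * A) ^ n * M"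
  using T_pow_bound[of "\<lambda>z. f z - g z", OF _ M z] hol
  by (simp add: T_pow_diff holomorphic_intros)

end

section \<open>Iterates on polynomials times exponentials\<close>

lemma higher_deriv_exp_mult:
  fixes l :: complex
  shows "(deriv ^^ k) (\<lambda>w. exp (l * w)) = (\<lambda>w. l ^ k * exp (l * w))"
proof (induction k)
  case (Suc k)
  have "deriv (\<lambda>w. l ^ k * exp (l * w)) z = l ^ Suc k * exp (l * z)" for z
    by (rule DERIV_imp_deriv) (auto intro!: derivative_eq_intros simp: algebra_simps)
  then show ?case using Suc by auto
qed simp

lemma higher_deriv_poly:
  fixes p :: "complex poly"
  shows "(deriv ^^ k) (poly p) = poly ((pderiv ^^ k) p)"
proof (induction k)
  case (Suc k)
  have "deriv (poly q) z = poly (pderiv q) z" for q :: "complex poly" and z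
    by (rule DERIV_imp_deriv) (rule poly_DERIV)
  then show ?case using Suc by auto
qed simp

lemma poly_holomorphic: "poly (p :: complex poly) holomorphic_on S"
  unfolding holomorphic_on_def
  by (metis field_differentiable_at_within field_differentiable_def poly_DERIV)

lemma uniform_limit_scalar:
  fixes g :: "complex \<Rightarrow> complex"
  assumes "a \<longlonglongrightarrow> a0" "bounded (g ` S)"
  shows "uniform_limit S (\<lambda>n z. a n * g z) (\<lambda>z. a0 * g z) sequentially"
proof -
  obtain M where M: "M > 0" "\<And>z. z \<in> S \<Longrightarrow> norm (g z) \<le> M"
    using assms(2) unfolding bounded_pos by auto
  show ?thesis
  proof (rule uniform_limitI)
    fix e :: real assume "e > 0"
    then have "e / M > 0" using M by simp
    then have "\<forall>\<^sub>F n in sequentially. norm (a n - a0) < e / M"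
      using assms(1) unfolding tendsto_iff dist_norm by blast
    then show "\<forall>\<^sub>F n in sequentially. \<forall>z\<in>S. dist (a n * g z) (a0 * g z) < e"
    proof eventually_elim
      case (elim n)
      have "norm (a n - a0) * norm (g z) < e" if "z \<in> S" for z
      proof -
        have "norm (a n - a0) * norm (g z) \<le> norm (a n - a0) * M"
          using M(2)[OF that] by (rule mult_left_mono) simp
        also have "\<dots> < e" using elim M(1) by (simp add: field_simps)
        finally show ?thesis .
      qed
      then show ?case by (simp add: dist_norm norm_mult left_diff_distrib[symmetric])
    qed
  qed
qed

lemma uniform_limit_sum_finite:
  fixes f :: "nat \<Rightarrow> nat \<Rightarrow> complex \<Rightarrow> complex"
  assumes "\<And>k. k \<le> d \<Longrightarrow> uniform_limit S (\<lambda>n. f k n) (g k) sequentially"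
  shows "uniform_limit S (\<lambda>n z. \<Sum>k\<le>d. f k n z) (\<lambda>z. \<Sum>k\<le>d. g k z) sequentially"
  using assms by (induction d) (auto intro!: uniform_limit_add)

lemma power_times_geometric_tendsto_0:
  assumes "0 \<le> x" "x < (1::real)"
  shows "(\<lambda>n. real n ^ k * x ^ n) \<longlonglongrightarrow> 0"
proof (cases "x = 0")
  case True
  have "\<forall>\<^sub>F n in sequentially. real n ^ k * x ^ n = 0"
    using eventually_gt_at_top[of 0] by eventually_elim (use True in auto)
  then show ?thesis by (rule tendsto_eventually)
next
  case False
  then have "x > 0" using assms by simp
  then show ?thesis using assms by real_asymp
qed

lemma binomial_times_geometric_tendsto_0:
  fixes x :: complex
  assumes "norm x < 1"
  shows "(\<lambda>n. of_nat (n choose k) * x ^ (n - k)) \<longlonglongrightarrow> 0"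
\<comment> \<open>The shift by \<open>k\<close> turns the truncated difference \<open>n - k\<close>
  into \<open>n\<close>; the binomial coefficient still grows only polynomially.\<close>
proof (rule LIMSEQ_offset[of _ k], rule Lim_null_comparison)
  show "(\<lambda>n. 2 ^ k * (real n ^ k * norm x ^ n) + 2 ^ k * real k ^ k * norm x ^ n) \<longlonglongrightarrow> 0"
    using power_times_geometric_tendsto_0[of "norm x" k] LIMSEQ_realpow_zero[of "norm x"] assms
    by (intro tendsto_add_zero tendsto_mult_right_zero) auto
  show "\<forall>\<^sub>F n in sequentially. norm (of_nat (n + k choose k) * x ^ (n + k - k))
      \<le> 2 ^ k * (real n ^ k * norm x ^ n) + 2 ^ k * real k ^ k * norm x ^ n"
  proof (rule always_eventually, rule allI)
    fix n
    have "real (n + k choose k) \<le> real (n + k) ^ k"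
      using of_nat_mono[OF binomial_le_pow[of k "n + k"], where 'a = real] by simp
    also have "\<dots> \<le> (2 * max (real n) (real k)) ^ k" by (intro power_mono) auto
    also have "\<dots> \<le> 2 ^ k * (real n ^ k + real k ^ k)"
      by (auto simp: power_mult_distrib max_def)
    finally have "real (n + k choose k) * norm x ^ n \<le> 2 ^ k * (real n ^ k + real k ^ k) * norm x ^ n"
      by (rule mult_right_mono) simp
    then show "norm (of_nat (n + k choose k) * x ^ (n + k - k))
      \<le> 2 ^ k * (real n ^ k * norm x ^ n) + 2 ^ k * real k ^ k * norm x ^ n"
      by (simp add: norm_mult norm_power algebra_simps)
  qed
qed

text \<open>For large \<open>n\<close> the numerator is at most \<open>n ^ (d - 1)\<close> and the
  denominator at least \<open>(n / d) ^ d\<close>.\<close>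

lemma binomial_ratio_tendsto_0:
  assumes "k < d"
  shows "(\<lambda>n. real (n choose k) / real (n choose d)) \<longlonglongrightarrow> 0"
proof (rule Lim_null_comparison)
  show "(\<lambda>n. real d ^ d * inverse (real n)) \<longlonglongrightarrow> 0"
    by (intro tendsto_mult_right_zero lim_inverse_n)
  show "\<forall>\<^sub>F n in sequentially. norm (real (n choose k) / real (n choose d)) \<le> real d ^ d * inverse (real n)"
    using eventually_ge_at_top[of "d + 1"]
  proof eventually_elim
    case (elim n)
    have n: "real n \<ge> 1" using elim by simp
    have "real (n choose k) \<le> real n ^ k"
      using of_nat_mono[OF binomial_le_pow[of k n], where 'a = real] elim assms by simp
    also have "\<dots> \<le> real n ^ (d - 1)" using n assms by (intro power_increasing) auto
    finally have 1: "real (n choose k) \<le> real n ^ (d - 1)" .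
    have 2: "(real n / real d) ^ d \<le> real (n choose d)"
      using binomial_ge_n_over_k_pow_k[of d n, where 'a = real] elim by simp
    have "real (n choose k) / real (n choose d) \<le> real n ^ (d - 1) / (real n / real d) ^ d"
      using 1 2 elim assms by (intro frac_le) auto
    also have "\<dots> = real d ^ d * inverse (real n)"
    proof -
      obtain m where "d = Suc m" using assms by (cases d) auto
      then show ?thesis using n by (simp add: power_divide field_simps)
    qed
    finally show ?case by simp
  qed
qed

section \<open>The scalar and nilpotent parts of the operator\<close>

context exp_coeffs
begin

text \<open>The Taylor coefficient of \<phi> at \<open>l\<close>, that is, its \<open>i\<close>-th
  derivative at \<open>l\<close> divided by \<open>fact i\<close>. Terms with \<open>j < i\<close>
  vanish through the binomial coefficient.\<close>

definition taylor :: "complex \<Rightarrow> nat \<Rightarrow> complex" where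
  "taylor l i = (\<Sum>j. c j * of_nat (j choose i) * l ^ (j - i))"

lemma summable_taylor: "summable (\<lambda>j. c j * of_nat (j choose i) * l ^ (j - i))"
proof (rule summable_comparison_test')
  define x where "x = 2 * B * (1 + norm l)"
  show "summable (\<lambda>j. A * (inverse (fact j) * x ^ j))"
    by (intro summable_mult summable_exp)
  show "norm (c j * of_nat (j choose i) * l ^ (j - i)) \<le> A * (inverse (fact j) * x ^ j)" for j
  proof -
    have 1: "real (j choose i) \<le> 2 ^ j"
      using binomial_le_pow2[of j i] by (metis of_nat_le_iff of_nat_numeral of_nat_power)
    have "norm l ^ (j - i) \<le> (1 + norm l) ^ (j - i)" by (intro power_mono) auto
    also have "\<dots> \<le> (1 + norm l) ^ j" by (intro power_increasing) auto
    finally have 2: "norm l ^ (j - i) \<le> (1 + norm l) ^ j" .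
    have "norm (c j * of_nat (j choose i) * l ^ (j - i))
        \<le> A * B ^ j / fact j * 2 ^ j * (1 + norm l) ^ j"
      unfolding norm_mult norm_power norm_of_nat
      using coeff_bound[of j] 1 2 A B by (intro mult_mono) auto
    also have "\<dots> = A * (inverse (fact j) * x ^ j)"
      unfolding x_def power_mult_distrib by (simp add: field_simps)
    finally show ?thesis .
  qed
qed

text \<open>The part without constant term of \<phi>(l + D), with D the derivative, cut after order
  \<open>d\<close>. Fixing \<open>d\<close> in advance keeps the operator the same when it is
  iterated on polynomials of degree at most \<open>d\<close>.\<close>

definition low :: "nat \<Rightarrow> complex \<Rightarrow> complex poly \<Rightarrow> complex poly" where
  "low d l p = (\<Sum>i=1..d. smult (taylor l i) ((pderiv ^^ i) p))"

definition op :: "nat \<Rightarrow> complex \<Rightarrow> complex poly \<Rightarrow> complex poly" where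
  "op d l p = smult (taylor l 0) p + low d l p"

text \<open>Conjugating \<phi>(D) by the exponential gives \<phi>(l + D). On polynomials this is a
  finite sum, so Leibniz' rule and an exchange of sums prove it.\<close>

lemma T_poly_exp:
  assumes deg: "degree p \<le> d"
  shows "T (\<lambda>z. poly p z * exp (l * z)) = (\<lambda>z. poly (op d l p) z * exp (l * z))"
proof
  fix z
  have vanish: "(pderiv ^^ i) p = 0" if "i > d" for i
    using that deg by (intro poly_eqI) (simp add: coeff_higher_pderiv coeff_eq_0)
  have deriv: "(deriv ^^ j) (\<lambda>z. poly p z * exp (l * z)) z =
      (\<Sum>i\<le>d. of_nat (j choose i) * l ^ (j - i) * (poly ((pderiv ^^ i) p) z * exp (l * z)))" for j
  proof -
    let ?g = "\<lambda>i. of_nat (j choose i) * l ^ (j - i) * (poly ((pderiv ^^ i) p) z * exp (l * z))"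
    have "(deriv ^^ j) (\<lambda>z. poly p z * exp (l * z)) z =
      (\<Sum>i=0..j. of_nat (j choose i) * (deriv ^^ i) (poly p) z * (deriv ^^ (j - i)) (\<lambda>z. exp (l * z)) z)"
      by (rule higher_deriv_mult[of _ UNIV]) (auto intro!: holomorphic_intros poly_holomorphic)
    also have "\<dots> = sum ?g {0..j}"
      unfolding higher_deriv_exp_mult higher_deriv_poly by (simp add: mult_ac)
    \<comment> \<open>Neither of \<open>j\<close> and \<open>d\<close> need be the larger, so the
      range is first enlarged, where \<open>j choose i = 0\<close>, and then cut, where the
      derivatives of \<open>p\<close> vanish.\<close>
    also have "\<dots> = sum ?g {..j + d}"
      by (rule sum.mono_neutral_left) auto
    also have "\<dots> = sum ?g {..d}"
      by (rule sum.mono_neutral_right) (auto simp: vanish)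
    finally show ?thesis .
  qed
  have "T (\<lambda>z. poly p z * exp (l * z)) z =
      (\<Sum>j. \<Sum>i\<le>d. c j * of_nat (j choose i) * l ^ (j - i) * (poly ((pderiv ^^ i) p) z * exp (l * z)))"
    unfolding T_def deriv by (simp add: sum_distrib_left mult_ac)
  also have "\<dots> = (\<Sum>i\<le>d. \<Sum>j. c j * of_nat (j choose i) * l ^ (j - i) * (poly ((pderiv ^^ i) p) z * exp (l * z)))"
    by (intro suminf_sum summable_mult2 summable_taylor)
  also have "\<dots> = (\<Sum>i\<le>d. taylor l i * (poly ((pderiv ^^ i) p) z * exp (l * z)))"
    unfolding taylor_def by (intro sum.cong refl suminf_mult2[symmetric] summable_taylor)
  also have "{..d} = insert 0 {1..d}" by auto
  also have "(\<Sum>i\<in>insert 0 {1..d}. taylor l i * (poly ((pderiv ^^ i) p) z * exp (l * z)))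
      = poly (op d l p) z * exp (l * z)"
    by (simp add: op_def low_def poly_sum sum_distrib_right distrib_right mult.assoc)
  finally show "T (\<lambda>z. poly p z * exp (l * z)) z = poly (op d l p) z * exp (l * z)" .
qed

lemma smult_sum_distrib: "smult a (sum f S) = (\<Sum>x\<in>S. smult a (f x))" for f :: "_ \<Rightarrow> complex poly"
  by (induction S rule: infinite_finite_induct) (simp_all add: smult_add_right)

lemma low_smult: "low d l (smult a p) = smult a (low d l p)"
  by (simp add: low_def higher_pderiv_smult smult_sum_distrib mult.commute)

lemma low_add: "low d l (p + q) = low d l p + low d l q"
  by (simp add: low_def higher_pderiv_add smult_add_right sum.distrib)

lemma low_sum: "low d l (sum f S) = (\<Sum>x\<in>S. low d l (f x))"
proof -
  have "low d l 0 = 0" using low_smult[of d l 0 0] by simp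
  then show ?thesis
    by (induction S rule: infinite_finite_induct) (simp_all add: low_add)
qed

lemma coeff_low: "coeff (low d l p) k =
    (\<Sum>i=1..d. taylor l i * (pochhammer (of_nat (Suc k)) i * coeff p (k + i)))"
  by (simp add: low_def coeff_sum coeff_higher_pderiv)

text \<open>Coefficient \<open>k\<close> of the image involves only coefficients of index above
  \<open>k\<close>, so degrees drop. Coefficients are used because \<open>degree\<close> does not
  tell zero from a nonzero constant.\<close>

lemma low_vanish:
  assumes "\<And>k. k > m \<Longrightarrow> coeff p k = 0" "k \<ge> m"
  shows "coeff (low d l p) k = 0"
  unfolding coeff_low using assms by (intro sum.neutral) auto

text \<open>Only the summand \<open>i = 1\<close> reaches the top coefficient; this is where the
  derivative of \<phi> at \<open>l\<close> comes in.\<close>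

lemma low_top:
  assumes "\<And>k. k > Suc m \<Longrightarrow> coeff p k = 0" "d \<ge> 1"
  shows "coeff (low d l p) m = taylor l 1 * (of_nat (Suc m) * coeff p (Suc m))"
proof -
  have "{1..d} = insert 1 {2..d}" using assms(2) by auto
  then have "coeff (low d l p) m = taylor l 1 * (pochhammer (of_nat (Suc m)) 1 * coeff p (m + 1)) +
     (\<Sum>i=2..d. taylor l i * (pochhammer (of_nat (Suc m)) i * coeff p (m + i)))"
    unfolding coeff_low by simp
  also have "(\<Sum>i=2..d. taylor l i * (pochhammer (of_nat (Suc m)) i * coeff p (m + i))) = 0"
    using assms(1) by (intro sum.neutral) auto
  finally show ?thesis by simp
qed

lemma low_pow_vanish:
  assumes "degree p = d"
  shows "k \<le> d \<Longrightarrow> m > d - k \<Longrightarrow> coeff ((low d l ^^ k) p) m = 0"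
proof (induction k arbitrary: m)
  case 0
  then show ?case using assms by (simp add: coeff_eq_0)
next
  case (Suc k)
  then show ?case using low_vanish[of "d - k" "(low d l ^^ k) p" m d l] by simp
qed

text \<open>By \<open>low_top\<close> each application lowers the degree by exactly one, so
  \<open>d\<close> applications leave a nonzero constant.\<close>

lemma low_pow_top:
  assumes "degree p = d" "p \<noteq> 0" "taylor l 1 \<noteq> 0"
  shows "k \<le> d \<Longrightarrow> coeff ((low d l ^^ k) p) (d - k) \<noteq> 0"
proof (induction k)
  case 0
  then show ?case using assms by auto
next
  case (Suc k)
  have *: "d - k = Suc (d - Suc k)" using Suc.prems by simp
  have "coeff (low d l ((low d l ^^ k) p)) (d - Suc k) =
     taylor l 1 * (of_nat (Suc (d - Suc k)) * coeff ((low d l ^^ k) p) (Suc (d - Suc k)))"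
    using low_pow_vanish[OF assms(1), of k] Suc.prems * by (intro low_top) auto
  then show ?case using Suc assms(3) * by (auto simp del: of_nat_Suc)
qed

lemma low_pow_top_const:
  assumes "degree p = d"
  shows "(low d l ^^ d) p = [:coeff ((low d l ^^ d) p) 0:]"
  using low_pow_vanish[OF assms, of d] by (intro poly_eqI) (simp add: coeff_pCons split: nat.split)

lemma low_pow_zero:
  assumes "degree p = d" "k > d"
  shows "(low d l ^^ k) p = 0"
proof -
  have "(low d l ^^ Suc d) p = 0"
    using low_vanish[of 0 "(low d l ^^ d) p"] low_pow_vanish[OF assms(1), of d]
    by (intro poly_eqI) auto
  moreover have "low d l 0 = 0" using low_smult[of d l 0 0] by simp
  then have "(low d l ^^ n) 0 = 0" for n by (induction n) auto
  ultimately show ?thesis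
    using funpow_add[of "k - Suc d" "Suc d" "low d l"] assms(2) by simp
qed

text \<open>The binomial theorem, as the scalar part commutes with \<open>low d l\<close>.\<close>

lemma op_pow:
  "(op d l ^^ n) p = (\<Sum>k\<le>n. smult (of_nat (n choose k) * taylor l 0 ^ (n - k)) ((low d l ^^ k) p))"
proof (induction n)
  case (Suc n)
  let ?x = "taylor l 0" let ?N = "\<lambda>k. (low d l ^^ k) p"
  let ?t = "\<lambda>k. smult (of_nat (n choose k) * ?x ^ (Suc n - k)) (?N k)"
  let ?u = "\<lambda>k. smult (of_nat (n choose k) * ?x ^ (n - k)) (?N (Suc k))"
  have "(op d l ^^ Suc n) p = smult ?x (\<Sum>k\<le>n. smult (of_nat (n choose k) * ?x ^ (n - k)) (?N k)) + (\<Sum>k\<le>n. ?u k)"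
    unfolding funpow.simps o_apply Suc op_def[of d l "\<Sum>k\<le>n. _ k"] low_sum low_smult ..
  also have "smult ?x (\<Sum>k\<le>n. smult (of_nat (n choose k) * ?x ^ (n - k)) (?N k)) = (\<Sum>k\<le>n. ?t k)"
    by (simp add: smult_sum_distrib Suc_diff_le mult_ac)
  \<comment> \<open>The new term has the factor \<open>n choose Suc n = 0\<close>; adding it aligns
    both sums for Pascal's rule.\<close>
  also have "\<dots> = (\<Sum>k\<le>Suc n. ?t k)" by simp
  also have "\<dots> = ?t 0 + (\<Sum>k\<le>n. ?t (Suc k))"
    by (simp add: sum.atMost_Suc_shift del: sum.atMost_Suc)
  also have "\<dots> + (\<Sum>k\<le>n. ?u k) = ?t 0 + (\<Sum>k\<le>n. ?t (Suc k) + ?u k)"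
    by (simp add: sum.distrib)
  also have "\<dots> = smult (of_nat (Suc n choose 0) * ?x ^ (Suc n - 0)) (?N 0) +
      (\<Sum>k\<le>n. smult (of_nat (Suc n choose Suc k) * ?x ^ (Suc n - Suc k)) (?N (Suc k)))"
    by (simp add: smult_add_left[symmetric] distrib_right add.commute)
  also have "\<dots> = (\<Sum>k\<le>Suc n. smult (of_nat (Suc n choose k) * ?x ^ (Suc n - k)) (?N k))"
    by (simp only: sum.atMost_Suc_shift)
  finally show ?case .
qed simp

lemma T_pow_poly_exp_op:
  assumes "degree p \<le> d"
  shows "(T ^^ n) (\<lambda>z. poly p z * exp (l * z)) = (\<lambda>z. poly ((op d l ^^ n) p) z * exp (l * z))"
proof -
  have "degree (low d l q) \<le> d" if "degree q \<le> d" for q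
    using that low_vanish[of d q _ d l] by (intro degree_le) (auto simp: coeff_eq_0)
  then have "degree (op d l q) \<le> d" if "degree q \<le> d" for q
    using that degree_smult_le[of "taylor l 0" q]
    by (auto simp: op_def intro!: degree_add_le intro: order_trans)
  then have "degree ((op d l ^^ n) p) \<le> d" for n
    using assms by (induction n) auto
  then show ?thesis by (induction n) (simp_all add: T_poly_exp)
qed

text \<open>Nilpotency leaves \<open>d + 1\<close> terms whatever \<open>n\<close> is, so limits in
  \<open>n\<close> can be taken term by term.\<close>

lemma T_pow_poly_exp:
  assumes "degree p = d"
  shows "(T ^^ n) (\<lambda>z. poly p z * exp (l * z)) =
    (\<lambda>z. \<Sum>k\<le>d. (of_nat (n choose k) * taylor l 0 ^ (n - k)) * (poly ((low d l ^^ k) p) z * exp (l * z)))"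
proof
  fix z
  let ?g = "\<lambda>k. (of_nat (n choose k) * taylor l 0 ^ (n - k)) * (poly ((low d l ^^ k) p) z * exp (l * z))"
  have "(T ^^ n) (\<lambda>z. poly p z * exp (l * z)) z = sum ?g {..n}"
    using T_pow_poly_exp_op[of p d n l] assms
    by (simp add: op_pow poly_sum sum_distrib_right mult.assoc)
  also have "\<dots> = sum ?g {..n + d}" by (rule sum.mono_neutral_left) auto
  also have "\<dots> = sum ?g {..d}"
    by (rule sum.mono_neutral_right) (auto simp: low_pow_zero[OF assms])
  finally show "(T ^^ n) (\<lambda>z. poly p z * exp (l * z)) z = sum ?g {..d}" .
qed

lemma bounded_poly_exp:
  "bounded ((\<lambda>z. poly q z * exp (l * z)) ` cball 0 R)" for q :: "complex poly"
  by (intro compact_imp_bounded compact_continuous_image continuous_intros) auto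

lemma T_pow_decay:
  assumes "norm (taylor l 0) < 1"
  shows "uniform_limit (cball 0 R) (\<lambda>n. (T ^^ n) (\<lambda>z. poly p z * exp (l * z))) (\<lambda>z. 0) sequentially"
proof -
  have "uniform_limit (cball 0 R) (\<lambda>n. (T ^^ n) (\<lambda>z. poly p z * exp (l * z)))
     (\<lambda>z. \<Sum>k\<le>degree p. 0 * (poly ((low (degree p) l ^^ k) p) z * exp (l * z))) sequentially"
    unfolding T_pow_poly_exp[OF refl]
    by (intro uniform_limit_sum_finite uniform_limit_scalar bounded_poly_exp
        binomial_times_geometric_tendsto_0 assms)
  then show ?thesis by simp
qed

text \<open>In \<open>T ^^ n\<close> applied to \<open>p\<close> times an exponential, the nilpotent part contributes a leading
  term of order \<open>n ^ degree p\<close> that is a constant multiple of the exponential itself.\<close>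

lemma T_pow_growth:
  assumes "norm (taylor l 0) > 1" "taylor l 1 \<noteq> 0" "p \<noteq> 0"
  obtains s :: "nat \<Rightarrow> complex" where "s \<longlonglongrightarrow> 0"
    "\<And>R. uniform_limit (cball 0 R) (\<lambda>n. (T ^^ n) (\<lambda>z. poly p z * (s n * exp (l * z))))
       (\<lambda>z. exp (l * z)) sequentially"
proof -
  define d where "d = degree p"
  define \<kappa> where "\<kappa> = coeff ((low d l ^^ d) p) 0"
  have \<kappa>: "\<kappa> \<noteq> 0" "(low d l ^^ d) p = [:\<kappa>:]"
    using low_pow_top[of p d l d] low_pow_top_const[of p d l] assms by (auto simp: \<kappa>_def d_def)
  define x where "x = taylor l 0"
  have x: "norm x > 1" "x \<noteq> 0" using assms by (auto simp: x_def)
  \<comment> \<open>The inverse of the factor that the term \<open>k = d\<close> puts before the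
    exponential, so that this term is exactly the exponential once \<open>n \<ge> d\<close>. For
    \<open>n < d\<close> the value is \<open>0\<close>.\<close>
  define s where "s n = inverse (\<kappa> * of_nat (n choose d) * x ^ (n - d))" for n
  have s0: "s \<longlonglongrightarrow> 0"
  proof (rule LIMSEQ_offset[of _ d], rule Lim_null_comparison)
    show "(\<lambda>n. inverse (norm \<kappa>) * inverse (norm x) ^ n) \<longlonglongrightarrow> 0"
      using x by (intro tendsto_mult_right_zero LIMSEQ_realpow_zero) (auto simp: field_simps)
    show "\<forall>\<^sub>F n in sequentially. norm (s (n + d)) \<le> inverse (norm \<kappa>) * inverse (norm x) ^ n"
    proof (rule always_eventually, rule allI)
      fix n
      have "1 \<le> (n + d choose d)" by (simp add: Suc_leI)
      then have "inverse (real (n + d choose d)) \<le> 1" by (simp add: field_simps)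
      then have "inverse (norm \<kappa>) * inverse (norm x) ^ n * inverse (real (n + d choose d)) \<le> inverse (norm \<kappa>) * inverse (norm x) ^ n"
        by (intro mult_left_le) auto
      then show "norm (s (n + d)) \<le> inverse (norm \<kappa>) * inverse (norm x) ^ n"
        by (simp add: s_def norm_mult norm_power norm_inverse power_inverse mult_ac)
    qed
  qed
  define t where "t k n = s n * (of_nat (n choose k) * x ^ (n - k))" for k n
  have td: "t d \<longlonglongrightarrow> inverse \<kappa>"
  proof (rule tendsto_eventually)
    show "\<forall>\<^sub>F n in sequentially. t d n = inverse \<kappa>"
      using eventually_ge_at_top[of d]
      by eventually_elim (use \<kappa> x in \<open>auto simp: t_def s_def field_simps\<close>)
  qed
  \<comment> \<open>Relative to the term \<open>k = d\<close> the power of \<open>x\<close> is the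
    constant \<open>d - k\<close>; the ratio of binomial coefficients forces the decay.\<close>
  have tk: "t k \<longlonglongrightarrow> 0" if "k < d" for k
  proof (rule Lim_null_comparison)
    show "(\<lambda>n. norm x ^ (d - k) * inverse (norm \<kappa>) * (real (n choose k) / real (n choose d))) \<longlonglongrightarrow> 0"
      by (intro tendsto_mult_right_zero binomial_ratio_tendsto_0 that)
    show "\<forall>\<^sub>F n in sequentially. norm (t k n) \<le> norm x ^ (d - k) * inverse (norm \<kappa>) * (real (n choose k) / real (n choose d))"
      using eventually_ge_at_top[of d]
    proof eventually_elim
      case (elim n)
      have "n - k = (n - d) + (d - k)" using elim that by simp
      then have "t k n = x ^ (d - k) * inverse \<kappa> * (of_nat (n choose k) / of_nat (n choose d))"
        using x by (simp add: t_def s_def power_add field_simps)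
      then show ?case by (simp add: norm_mult norm_power norm_inverse norm_divide)
    qed
  qed
  show ?thesis
  proof (rule that[OF s0])
    fix R
    define L where "L k = (if k = d then inverse \<kappa> else 0)" for k
    have "t k \<longlonglongrightarrow> L k" if "k \<le> d" for k using td tk that by (auto simp: L_def)
    then have "uniform_limit (cball 0 R) (\<lambda>n z. \<Sum>k\<le>d. t k n * (poly ((low d l ^^ k) p) z * exp (l * z)))
       (\<lambda>z. \<Sum>k\<le>d. L k * (poly ((low d l ^^ k) p) z * exp (l * z))) sequentially"
      by (intro uniform_limit_sum_finite uniform_limit_scalar bounded_poly_exp)
    also have "(\<lambda>z. \<Sum>k\<le>d. L k * (poly ((low d l ^^ k) p) z * exp (l * z))) = (\<lambda>z. exp (l * z))"
      using \<kappa> by (auto simp: L_def if_distrib[of "\<lambda>x. x * _"] cong: if_cong)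
    also have "(\<lambda>n z. \<Sum>k\<le>d. t k n * (poly ((low d l ^^ k) p) z * exp (l * z))) =
        (\<lambda>n. (T ^^ n) (\<lambda>z. poly p z * (s n * exp (l * z))))"
    proof
      fix n
      have "(T ^^ n) (\<lambda>z. poly p z * (s n * exp (l * z))) = (T ^^ n) (\<lambda>z. s n * (poly p z * exp (l * z)))"
        by (simp add: mult_ac)
      also have "\<dots> = (\<lambda>z. s n * (T ^^ n) (\<lambda>z. poly p z * exp (l * z)) z)"
        by (intro T_pow_cmult holomorphic_intros poly_holomorphic)
      also have "\<dots> = (\<lambda>z. \<Sum>k\<le>d. t k n * (poly ((low d l ^^ k) p) z * exp (l * z)))"
        by (simp add: T_pow_poly_exp d_def t_def x_def sum_distrib_left mult.assoc)
      finally show "(\<lambda>z. \<Sum>k\<le>d. t k n * (poly ((low d l ^^ k) p) z * exp (l * z))) =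
        (T ^^ n) (\<lambda>z. poly p z * (s n * exp (l * z)))" by simp
    qed
    finally show "uniform_limit (cball 0 R) (\<lambda>n. (T ^^ n) (\<lambda>z. poly p z * (s n * exp (l * z))))
       (\<lambda>z. exp (l * z)) sequentially" .
  qed
qed

end

section \<open>A polynomial factor near 1 that sends an iterate to a given target\<close>

lemma norm_diff_four:
  fixes a b u g f :: complex
  assumes "norm a < \<eta>" "norm (b - u) < \<eta>" "norm (g - u) < \<eta>" "norm (a + b - f) \<le> \<eta>"
  shows "norm (f - g) < 4 * \<eta>"
proof -
  have "norm (f - g) \<le> norm (a + (b - u)) + norm ((g - u) + (a + b - f))"
    using norm_triangle_ineq4[of "a + (b - u)" "(g - u) + (a + b - f)"] by (simp add: algebra_simps)
  then show ?thesis
    using norm_triangle_ineq[of a "b - u"] norm_triangle_ineq[of "g - u" "a + b - f"] assms by linarith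
qed

context exp_coeffs
begin

lemma exp_span_decay:
  assumes "v \<in> exp_span \<Lambda>" "\<And>l. l \<in> \<Lambda> \<Longrightarrow> norm (taylor l 0) < 1"
  shows "uniform_limit (cball 0 R) (\<lambda>n. (T ^^ n) (\<lambda>z. poly p z * v z)) (\<lambda>z. 0) sequentially"
  using assms(1)
proof (induction rule: exp_span.induct)
  case (single l a)
  have "uniform_limit (cball 0 R) (\<lambda>n. (T ^^ n) (\<lambda>z. poly (smult a p) z * exp (l * z))) (\<lambda>z. 0) sequentially"
    using assms(2)[OF single] by (rule T_pow_decay)
  then show ?case by (simp add: mult_ac)
next
  case (add u v)
  have "(T ^^ n) (\<lambda>z. poly p z * (u z + v z)) =
      (\<lambda>z. (T ^^ n) (\<lambda>z. poly p z * u z) z + (T ^^ n) (\<lambda>z. poly p z * v z) z)" for n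
    using exp_span_holomorphic add(1,2)
    by (simp add: distrib_left T_pow_add poly_holomorphic holomorphic_intros)
  then show ?case using uniform_limit_add[OF add.IH] by simp
qed

text \<open>An approximate right inverse of \<open>T ^^ n\<close> after multiplication by
  \<open>p\<close>. The limits run along all \<open>n\<close> and not along a subsequence, so the
  sequences of two summands can be added.\<close>

lemma exp_span_growth:
  assumes "u \<in> exp_span \<Lambda>" "p \<noteq> 0"
    and \<Lambda>: "\<And>l. l \<in> \<Lambda> \<Longrightarrow> norm (taylor l 0) > 1 \<and> taylor l 1 \<noteq> 0"
  shows "\<exists>w. (\<forall>n. w n holomorphic_on UNIV) \<and>
     (\<forall>R. uniform_limit (cball 0 R) w (\<lambda>z. 0) sequentially) \<and>
     (\<forall>R. uniform_limit (cball 0 R) (\<lambda>n. (T ^^ n) (\<lambda>z. poly p z * w n z)) u sequentially)"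
  using assms(1)
proof (induction rule: exp_span.induct)
  case (single l a)
  obtain s where s: "s \<longlonglongrightarrow> 0"
    "\<And>R. uniform_limit (cball 0 R) (\<lambda>n. (T ^^ n) (\<lambda>z. poly p z * (s n * exp (l * z))))
       (\<lambda>z. exp (l * z)) sequentially"
    using T_pow_growth[of l p] \<Lambda>[OF single] assms(2) by blast
  define w where "w n z = (a * s n) * exp (l * z)" for n z
  have "w n holomorphic_on UNIV" for n
    unfolding w_def by (intro holomorphic_intros)
  moreover have "uniform_limit (cball 0 R) w (\<lambda>z. 0) sequentially" for R
  proof -
    have "uniform_limit (cball 0 R) (\<lambda>n z. (a * s n) * exp (l * z)) (\<lambda>z. (a * 0) * exp (l * z)) sequentially"
      using bounded_poly_exp[of 1 l R] by (intro uniform_limit_scalar tendsto_intros s(1)) simp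
    then show ?thesis by (simp add: w_def[abs_def])
  qed
  moreover have "uniform_limit (cball 0 R) (\<lambda>n. (T ^^ n) (\<lambda>z. poly p z * w n z)) (\<lambda>z. a * exp (l * z)) sequentially" for R
  proof -
    have "(T ^^ n) (\<lambda>z. poly p z * w n z) = (\<lambda>z. a * (T ^^ n) (\<lambda>z. poly p z * (s n * exp (l * z))) z)" for n
    proof -
      have "(\<lambda>z. poly p z * w n z) = (\<lambda>z. a * (poly p z * (s n * exp (l * z))))"
        by (simp add: w_def mult_ac)
      then show ?thesis by (simp add: T_pow_cmult poly_holomorphic holomorphic_intros)
    qed
    moreover have "uniform_limit (cball 0 R) (\<lambda>n z. a * (T ^^ n) (\<lambda>z. poly p z * (s n * exp (l * z))) z)
        (\<lambda>z. a * exp (l * z)) sequentially"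
      by (rule bounded_linear.uniform_limit[OF bounded_linear_mult_right s(2)])
    ultimately show ?thesis by simp
  qed
  ultimately show ?case by blast
next
  case (add u1 u2)
  obtain w1 where w1: "\<And>n. w1 n holomorphic_on UNIV" "\<And>R. uniform_limit (cball 0 R) w1 (\<lambda>z. 0) sequentially"
    "\<And>R. uniform_limit (cball 0 R) (\<lambda>n. (T ^^ n) (\<lambda>z. poly p z * w1 n z)) u1 sequentially"
    using add.IH(1) by blast
  obtain w2 where w2: "\<And>n. w2 n holomorphic_on UNIV" "\<And>R. uniform_limit (cball 0 R) w2 (\<lambda>z. 0) sequentially"
    "\<And>R. uniform_limit (cball 0 R) (\<lambda>n. (T ^^ n) (\<lambda>z. poly p z * w2 n z)) u2 sequentially"
    using add.IH(2) by blast
  define w where "w n z = w1 n z + w2 n z" for n z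
  have "w n holomorphic_on UNIV" for n
    unfolding w_def using w1(1) w2(1) by (intro holomorphic_intros)
  moreover have "uniform_limit (cball 0 R) w (\<lambda>z. 0) sequentially" for R
    using uniform_limit_add[OF w1(2) w2(2), of R] by (simp add: w_def[abs_def])
  moreover have "(T ^^ n) (\<lambda>z. poly p z * w n z) =
      (\<lambda>z. (T ^^ n) (\<lambda>z. poly p z * w1 n z) z + (T ^^ n) (\<lambda>z. poly p z * w2 n z) z)" for n
    using w1(1) w2(1) by (simp add: w_def distrib_left T_pow_add poly_holomorphic holomorphic_intros)
  then have "uniform_limit (cball 0 R) (\<lambda>n. (T ^^ n) (\<lambda>z. poly p z * w n z)) (\<lambda>z. u1 z + u2 z) sequentially" for R
    using uniform_limit_add[OF w1(3) w2(3), of R] by simp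
  ultimately show ?case by blast
qed

text \<open>Take \<open>v\<close> near \<open>1\<close> in the decaying span and \<open>w n\<close>
  small with \<open>T ^^ n\<close> of \<open>p * w n\<close> near \<open>g\<close>. Then
  \<open>v + w n\<close> works for all large \<open>n\<close>; a polynomial close to it, divided by
  its value at \<open>0\<close>, is \<open>q\<close>.\<close>

lemma step_polynomial:
  assumes \<Lambda>1: "open \<Lambda>1" "\<Lambda>1 \<noteq> {}" "\<And>l. l \<in> \<Lambda>1 \<Longrightarrow> norm (taylor l 0) < 1"
    and \<Lambda>2: "open \<Lambda>2" "\<Lambda>2 \<noteq> {}" "\<And>l. l \<in> \<Lambda>2 \<Longrightarrow> norm (taylor l 0) > 1 \<and> taylor l 1 \<noteq> 0"
    and "p \<noteq> 0" and g: "g holomorphic_on UNIV" and S: "S \<ge> 0" and R: "R \<ge> 0" and e: "e > 0"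
  obtains q :: "complex poly" and n where "n \<ge> 1" "poly q 0 = 1"
    "\<And>z. norm z \<le> S \<Longrightarrow> norm (poly q z - 1) < e"
    "\<And>z. norm z \<le> R \<Longrightarrow> norm ((T ^^ n) (\<lambda>z. poly p z * poly q z) z - g z) < e"
proof -
  obtain G where G: "G > 0" "\<And>z. norm z \<le> R \<Longrightarrow> norm (g z) \<le> G"
    using entire_bounded_on_cball[OF holomorphic_on_imp_continuous_on[OF g]] by metis
  \<comment> \<open>The bound \<open>1/6\<close> keeps \<open>a\<close> within \<open>1/2\<close> of
    \<open>1\<close>. After division by \<open>a\<close> the errors are at most
    \<open>12 * \<eta>\<close> and \<open>(8 + 6 * G) * \<eta>\<close>, both below
    \<open>(13 + 6 * G) * \<eta>\<close>.\<close>
  define \<eta> where "\<eta> = min (1/6) (e / (13 + 6 * G))"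
  have \<eta>: "\<eta> > 0" "\<eta> \<le> 1/6" "\<eta> * (13 + 6 * G) \<le> e"
  proof -
    have "\<eta> \<le> e / (13 + 6 * G)" by (simp add: \<eta>_def)
    then show "\<eta> * (13 + 6 * G) \<le> e" using G by (simp add: field_simps)
    show "\<eta> > 0" using e G by (simp add: \<eta>_def)
    show "\<eta> \<le> 1/6" unfolding \<eta>_def by (rule min.cobounded1)
  qed
  obtain v where v: "v \<in> exp_span \<Lambda>1" "\<forall>z\<in>cball 0 S. norm (1 - v z) < \<eta>"
    using exp_span_dense[OF \<Lambda>1(1,2) holomorphic_on_const[of 1], of S] \<eta>(1) unfolding approx_on_def by blast
  obtain u where u: "u \<in> exp_span \<Lambda>2" "\<forall>z\<in>cball 0 R. norm (g z - u z) < \<eta>"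
    using exp_span_dense[OF \<Lambda>2(1,2) g, of R] \<eta>(1) unfolding approx_on_def by blast
  obtain w where w: "\<And>n. w n holomorphic_on UNIV" "\<And>R. uniform_limit (cball 0 R) w (\<lambda>z. 0) sequentially"
    "\<And>R. uniform_limit (cball 0 R) (\<lambda>n. (T ^^ n) (\<lambda>z. poly p z * w n z)) u sequentially"
    using exp_span_growth[OF u(1) \<open>p \<noteq> 0\<close> \<Lambda>2(3)] by blast
  have "\<forall>\<^sub>F n in sequentially. (\<forall>z\<in>cball 0 S. dist (w n z) 0 < \<eta>) \<and>
      (\<forall>z\<in>cball 0 R. dist ((T ^^ n) (\<lambda>z. poly p z * w n z) z) (u z) < \<eta>) \<and>
      (\<forall>z\<in>cball 0 R. dist ((T ^^ n) (\<lambda>z. poly p z * v z) z) 0 < \<eta>) \<and> n \<ge> 1"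
    using w(2)[of S] w(3)[of R] exp_span_decay[OF v(1) \<Lambda>1(3), where R = R and p = p] \<eta>(1)
    unfolding uniform_limit_iff by (intro eventually_conj eventually_ge_at_top) blast+
  then obtain n where n: "n \<ge> 1" "\<And>z. norm z \<le> S \<Longrightarrow> norm (w n z) < \<eta>"
      "\<And>z. norm z \<le> R \<Longrightarrow> norm ((T ^^ n) (\<lambda>z. poly p z * w n z) z - u z) < \<eta>"
      "\<And>z. norm z \<le> R \<Longrightarrow> norm ((T ^^ n) (\<lambda>z. poly p z * v z) z) < \<eta>"
    by (auto simp: eventually_sequentially dist_norm)
  define q0 where "q0 z = v z + w n z" for z
  have hol_v: "v holomorphic_on UNIV" using v(1) by (rule exp_span_holomorphic)
  have hol_q0: "q0 holomorphic_on UNIV"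
    unfolding q0_def using hol_v w(1) by (intro holomorphic_intros)
  define S' where "S' = max S (R + real n * (2 * B))"
  obtain M where M: "M > 0" "\<And>z. norm z \<le> S' \<Longrightarrow> norm (poly p z) \<le> M"
    using entire_bounded_on_cball[OF holomorphic_on_imp_continuous_on[OF poly_holomorphic]] by metis
  \<comment> \<open>As \<open>n\<close> is now fixed, the polynomial \<open>r\<close> can be taken
    so close to \<open>q0\<close> that \<open>(2 * A) ^ n\<close> and the bound for \<open>p\<close>
    are absorbed.\<close>
  define \<theta> where "\<theta> = min \<eta> (\<eta> / ((2 * A) ^ n * M))"
  have \<theta>: "\<theta> > 0" "\<theta> \<le> \<eta>" "(2 * A) ^ n * (M * \<theta>) \<le> \<eta>"
  proof -
    have pos: "(2 * A) ^ n * M > 0" using A M by simp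
    have "\<theta> \<le> \<eta> / ((2 * A) ^ n * M)" by (simp add: \<theta>_def)
    then show "(2 * A) ^ n * (M * \<theta>) \<le> \<eta>" using pos by (simp add: field_simps)
    show "\<theta> > 0" "\<theta> \<le> \<eta>" using \<eta>(1) pos by (auto simp: \<theta>_def)
  qed
  obtain r where r: "\<And>z. z \<in> cball 0 S' \<Longrightarrow> norm (q0 z - poly r z) < \<theta>"
    using polynomial_approximation[OF holomorphic_on_subset[OF hol_q0], of "S' + 1" S' \<theta>] \<theta>(1) by auto
  \<comment> \<open>Dividing by this value, which is near \<open>1\<close>, normalises
    \<open>q\<close> at \<open>0\<close>, so that it factors into terms
    \<open>1 - z / b\<close>.\<close>
  define a where "a = poly r 0"
  have r1: "norm (poly r z - 1) < 3 * \<eta>" if "norm z \<le> S" for z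
  proof -
    have "z \<in> cball 0 S'" using that by (simp add: S'_def)
    then have "norm (q0 z - poly r z) < \<eta>" using r \<theta>(2) less_le_trans by blast
    moreover have "norm (1 - v z) < \<eta>" "norm (w n z) < \<eta>" using v(2) n(2) that by auto
    moreover have "norm (poly r z - 1) \<le> norm (1 - v z) + norm (w n z) + norm (q0 z - poly r z)"
      using norm_triangle_ineq4[of "w n z - (1 - v z)" "q0 z - poly r z"] norm_triangle_ineq4[of "w n z" "1 - v z"]
      by (simp add: q0_def algebra_simps)
    ultimately show ?thesis by simp
  qed
  have a1: "norm (a - 1) < 3 * \<eta>" using r1[of 0] S by (simp add: a_def)
  have a2: "norm a \<ge> 1/2"
    using norm_triangle_ineq2[of 1 "1 - a"] a1 \<eta>(2) by (simp add: norm_minus_commute)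
  then have a0: "a \<noteq> 0" by auto
  define F where "F = (T ^^ n) (\<lambda>z. poly p z * poly r z)"
  have F: "norm (F z - g z) < 4 * \<eta>" if z: "norm z \<le> R" for z
  proof -
    have "norm ((T ^^ n) (\<lambda>z. poly p z * q0 z) z - F z) \<le> (2 * A) ^ n * (M * \<theta>)"
      unfolding F_def
    proof (rule T_pow_diff_bound[OF _ _ _ z])
      show "norm (poly p y * q0 y - poly p y * poly r y) \<le> M * \<theta>" if "norm y \<le> R + real n * (2 * B)" for y
      proof -
        have y: "norm y \<le> S'" using that by (simp add: S'_def)
        have "norm (poly p y) * norm (q0 y - poly r y) \<le> M * \<theta>"
          using r[of y] M y by (intro mult_mono) auto
        then show ?thesis by (simp add: norm_mult right_diff_distrib[symmetric])
      qed
    qed (intro holomorphic_intros poly_holomorphic hol_q0)+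
    then have 1: "norm ((T ^^ n) (\<lambda>z. poly p z * q0 z) z - F z) \<le> \<eta>" using \<theta>(3) by simp
    have "(T ^^ n) (\<lambda>z. poly p z * q0 z) z =
       (T ^^ n) (\<lambda>z. poly p z * v z) z + (T ^^ n) (\<lambda>z. poly p z * w n z) z"
      using hol_v w(1) by (simp add: q0_def distrib_left T_pow_add poly_holomorphic holomorphic_intros)
    with 1 have 2: "norm ((T ^^ n) (\<lambda>z. poly p z * v z) z + (T ^^ n) (\<lambda>z. poly p z * w n z) z - F z) \<le> \<eta>"
      by simp
    have "norm (g z - u z) < \<eta>" using u(2) z by simp
    then show ?thesis using norm_diff_four[OF n(4,3)[OF z] _ 2] by simp
  qed
  show ?thesis
  proof (rule that[of n "smult (inverse a) r"])
    show "poly (smult (inverse a) r) 0 = 1" using a0 by (simp add: a_def)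
    show "norm (poly (smult (inverse a) r) z - 1) < e" if z: "norm z \<le> S" for z
    proof -
      have "norm (poly r z - a) < 6 * \<eta>"
        using norm_triangle_ineq4[of "poly r z - 1" "a - 1"] r1[OF z] a1 by simp
      moreover have "poly (smult (inverse a) r) z - 1 = (poly r z - a) / a"
        using a0 by (simp add: field_simps)
      ultimately have "norm (poly (smult (inverse a) r) z - 1) < 6 * \<eta> / norm a"
        using a0 by (simp add: norm_divide divide_strict_right_mono)
      also have "\<dots> \<le> 6 * \<eta> / (1/2)" using a2 \<eta>(1) by (intro divide_left_mono) auto
      also have "\<dots> \<le> \<eta> * (13 + 6 * G)" using \<eta>(1) G by (simp add: algebra_simps)
      finally show ?thesis using \<eta>(3) by simp
    qed
    show "norm ((T ^^ n) (\<lambda>z. poly p z * poly (smult (inverse a) r) z) z - g z) < e" if z: "norm z \<le> R" for z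
    proof -
      have "(\<lambda>z. poly p z * poly (smult (inverse a) r) z) = (\<lambda>z. inverse a * (poly p z * poly r z))"
        by (simp add: mult_ac)
      then have "(T ^^ n) (\<lambda>z. poly p z * poly (smult (inverse a) r) z) z = inverse a * F z"
        by (simp add: T_pow_cmult F_def poly_holomorphic holomorphic_intros)
      also have "inverse a * F z - g z = ((F z - g z) - (a - 1) * g z) / a"
        using a0 by (simp add: field_simps)
      also have "norm \<dots> = norm ((F z - g z) - (a - 1) * g z) / norm a" by (rule norm_divide)
      also have "\<dots> \<le> (4 * \<eta> + 3 * \<eta> * G) / norm a"
      proof (rule divide_right_mono)
        have "norm ((a - 1) * g z) \<le> 3 * \<eta> * G"
          unfolding norm_mult using a1 G(2)[OF z] \<eta>(1) by (intro mult_mono) auto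
        then show "norm ((F z - g z) - (a - 1) * g z) \<le> 4 * \<eta> + 3 * \<eta> * G"
          using norm_triangle_ineq4[of "F z - g z" "(a - 1) * g z"] F[OF z] by linarith
      qed simp
      also have "\<dots> \<le> (4 * \<eta> + 3 * \<eta> * G) / (1/2)"
        using a2 \<eta>(1) G(1) by (intro divide_left_mono) auto
      also have "\<dots> < \<eta> * (13 + 6 * G)" using \<eta>(1) by (simp add: algebra_simps)
      finally show ?thesis using \<eta>(3) by simp
    qed
  qed (use n in auto)
qed

end

section \<open>Approximation by products of linear factors\<close>

text \<open>A list because order and multiplicity matter: its prefixes are the partial
  products.\<close>

definition lin_prod :: "complex list \<Rightarrow> complex \<Rightarrow> complex" where
  "lin_prod ys z = (\<Prod>a\<leftarrow>ys. 1 - z / a)"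

lemma lin_prod_simps [simp]:
  "lin_prod [] z = 1"
  "lin_prod (a # ys) z = (1 - z / a) * lin_prod ys z"
  "lin_prod (xs @ ys) z = lin_prod xs z * lin_prod ys z"
  by (simp_all add: lin_prod_def)

text \<open>A factor \<open>[:- b, 1:]\<close> becomes \<open>1 - z / b\<close> when
  \<open>- b\<close> is moved into the cofactor, whose value at \<open>0\<close> is then again
  \<open>1\<close>.\<close>

lemma polynomial_eq_lin_prod:
  fixes p :: "complex poly"
  assumes "poly p 0 = 1"
  obtains bs where "0 \<notin> set bs" "\<And>z. lin_prod bs z = poly p z" "length bs = degree p"
    "\<And>b. b \<in> set bs \<Longrightarrow> poly p b = 0"
proof -
  have "\<exists>bs. 0 \<notin> set bs \<and> (\<forall>z. lin_prod bs z = poly p z) \<and> length bs = degree p \<and>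
      (\<forall>b\<in>set bs. poly p b = 0)"
    using assms
  proof (induction "degree p" arbitrary: p)
    case 0
    then obtain c where "p = [:c:]" by (metis degree_eq_zeroE)
    then show ?case using 0 by (intro exI[of _ "[]"]) auto
  next
    case (Suc n)
    then have "degree p \<in> {1..degree p}" "coeff p (degree p) \<noteq> 0" by auto
    then obtain b where b: "poly p b = 0"
      using fundamental_theorem_of_algebra[of "coeff p" "degree p"] unfolding poly_altdef by blast
    then have b0: "b \<noteq> 0" using Suc.prems by auto
    obtain r where r: "p = [:- b, 1:] * r" using b by (auto simp: poly_eq_0_iff_dvd dvd_def)
    then have "r \<noteq> 0" using Suc.prems by auto
    then have deg: "n = degree (smult (- b) r)"
      using Suc.hyps(2) b0 unfolding r by (subst (asm) degree_mult_eq) auto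
    have eq: "poly p z = (1 - z / b) * poly (smult (- b) r) z" for z
      using b0 by (simp add: r field_simps)
    have "poly (smult (- b) r) 0 = 1" using eq[of 0] Suc.prems by simp
    from Suc.hyps(1)[OF deg this] obtain bs where bs: "0 \<notin> set bs"
      "\<forall>z. lin_prod bs z = poly (smult (- b) r) z" "length bs = degree (smult (- b) r)"
      "\<forall>b'\<in>set bs. poly (smult (- b) r) b' = 0" by blast
    have "\<forall>b'\<in>set (b # bs). poly p b' = 0" using bs(4) b eq by auto
    then show ?case
      using bs b0 deg Suc.hyps(2) eq by (intro exI[of _ "b # bs"]) auto
  qed
  then show ?thesis using that by blast
qed

text \<open>Bounding by the product over the whole list \<open>us @ vs\<close> gives one constant
  for all prefixes \<open>us\<close>.\<close>

lemma lin_prod_norm_le: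
  assumes "norm z \<le> S"
  shows "norm (lin_prod us z) \<le> (\<Prod>a\<leftarrow>us @ vs. 1 + S / norm a)"
proof -
  have S: "S \<ge> 0" using assms norm_ge_zero order_trans by blast
  have 1: "1 \<le> (\<Prod>a\<leftarrow>xs. 1 + S / norm (a::complex))" for xs
  proof (induction xs)
    case (Cons a xs)
    then show ?case using S mult_mono[of 1 "1 + S / norm a" 1 "\<Prod>a\<leftarrow>xs. 1 + S / norm a"] by simp
  qed simp
  show ?thesis
  proof (induction us)
    case (Cons a us)
    have "norm (1 - z / a) \<le> 1 + S / norm a"
    proof -
      have "norm (1 - z / a) \<le> 1 + norm z / norm a"
        using norm_triangle_ineq4[of 1 "z / a"] by (simp add: norm_divide)
      also have "\<dots> \<le> 1 + S / norm a" using assms by (simp add: divide_right_mono)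
      finally show ?thesis .
    qed
    then have "norm (1 - z / a) * norm (lin_prod us z) \<le> (1 + S / norm a) * (\<Prod>a\<leftarrow>us @ vs. 1 + S / norm a)"
      using Cons S by (intro mult_mono) auto
    then show ?case by (simp add: norm_mult)
  qed (use 1 in auto)
qed

lemma lin_prod_minus_one_le:
  assumes "norm z \<le> S" "X > 0" "\<And>a. a \<in> set us \<Longrightarrow> X \<le> norm a"
  shows "norm (lin_prod us z - 1) \<le> (1 + S / X) ^ length us - 1"
  using assms(3)
proof (induction us)
  case (Cons a us)
  have S: "S \<ge> 0" using assms(1) norm_ge_zero order_trans by blast
  have "norm z / norm a \<le> S / X" using Cons.prems[of a] assms S by (intro frac_le) auto
  then have 1: "norm (z / a) \<le> S / X" by (simp add: norm_divide)
  have IH: "norm (lin_prod us z - 1) \<le> (1 + S / X) ^ length us - 1" using Cons by simp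
  have "norm (1 - z / a) \<le> 1 + S / X"
    using norm_triangle_ineq4[of 1 "z / a"] 1 by simp
  then have "norm ((1 - z / a) * (lin_prod us z - 1)) \<le> (1 + S / X) * ((1 + S / X) ^ length us - 1)"
    unfolding norm_mult using IH S assms(2) by (intro mult_mono) auto
  moreover have "lin_prod (a # us) z - 1 = (1 - z / a) * (lin_prod us z - 1) - z / a"
    by (simp add: algebra_simps)
  ultimately have "norm (lin_prod (a # us) z - 1) \<le> (1 + S / X) * ((1 + S / X) ^ length us - 1) + S / X"
    using norm_triangle_ineq4[of "(1 - z / a) * (lin_prod us z - 1)" "z / a"] 1 by simp
  also have "\<dots> = (1 + S / X) ^ length (a # us) - 1" by (simp add: algebra_simps)
  finally show ?case .
qed simp

text \<open>\<open>product_path R \<delta> f g\<close>: multiplying \<open>f\<close> by linear factors, one after the other, one can come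
  arbitrarily close to \<open>g\<close> on every disc while staying \<open>\<delta>\<close>-close to \<open>1\<close> on the disc of
  radius \<open>R\<close>.\<close>

definition product_path :: "real \<Rightarrow> real \<Rightarrow> (complex \<Rightarrow> complex) \<Rightarrow> (complex \<Rightarrow> complex) \<Rightarrow> bool" where
  "product_path R \<delta> f g \<longleftrightarrow> (\<forall>S \<eta>. \<eta> > 0 \<longrightarrow> (\<exists>ys. 0 \<notin> set ys \<and>
     (\<forall>z. norm z \<le> S \<longrightarrow> norm (f z * lin_prod ys z - g z) < \<eta>) \<and>
     (\<forall>us vs z. ys = us @ vs \<longrightarrow> norm z \<le> R \<longrightarrow> norm (f z * lin_prod us z - 1) < \<delta> + \<eta>)))"

lemma product_pathD:
  assumes "product_path R \<delta> f g" "\<eta> > 0"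
  obtains ys where "0 \<notin> set ys" "\<And>z. norm z \<le> S \<Longrightarrow> norm (f z * lin_prod ys z - g z) < \<eta>"
    "\<And>us vs z. ys = us @ vs \<Longrightarrow> norm z \<le> R \<Longrightarrow> norm (f z * lin_prod us z - 1) < \<delta> + \<eta>"
  using assms unfolding product_path_def by metis

lemma product_path_refl:
  assumes "\<And>z. norm z \<le> R \<Longrightarrow> norm (f z - 1) \<le> \<delta>"
  shows "product_path R \<delta> f f"
  unfolding product_path_def
proof (intro allI impI exI[of _ "[]"] conjI)
  fix S \<eta> :: real and us vs :: "complex list" and z :: complex
  assume "\<eta> > 0" "[] = us @ vs" "norm z \<le> R"
  then show "norm (f z * lin_prod us z - 1) < \<delta> + \<eta>" using assms[of z] by simp
qed auto

lemma product_path_linear_factor: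
  assumes "b \<noteq> 0" "\<And>z. norm z \<le> R \<Longrightarrow> norm (f z - 1) \<le> \<delta>"
    "\<And>z. norm z \<le> R \<Longrightarrow> norm (f z * (1 - z / b) - 1) \<le> \<delta>"
  shows "product_path R \<delta> f (\<lambda>z. f z * (1 - z / b))"
  unfolding product_path_def
proof (intro allI impI exI[of _ "[b]"] conjI)
  fix S \<eta> :: real and us vs :: "complex list" and z :: complex
  assume *: "\<eta> > 0" "[b] = us @ vs" "norm z \<le> R"
  then have "us = [] \<or> us = [b]" by (cases us) auto
  then show "norm (f z * lin_prod us z - 1) < \<delta> + \<eta>" using assms(2,3)[of z] * by auto
qed (use assms(1) in auto)

text \<open>Prefixes of the second list multiply the error of the first, so the second list is
  chosen first and the first one to accuracy \<open>\<eta> / (2 * M)\<close>. All losses go into the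
  arbitrary \<eta>; \<delta> stays the same, so any number of paths can be chained.\<close>

lemma product_path_trans:
  assumes "product_path R \<delta> f g" "product_path R \<delta> g h"
  shows "product_path R \<delta> f h"
  unfolding product_path_def
proof (intro allI impI)
  fix S \<eta> :: real assume \<eta>: "\<eta> > 0"
  define S' where "S' = max 0 (max S R)"
  obtain ys2 where ys2: "0 \<notin> set ys2" "\<And>z. norm z \<le> S' \<Longrightarrow> norm (g z * lin_prod ys2 z - h z) < \<eta> / 2"
    "\<And>us vs z. ys2 = us @ vs \<Longrightarrow> norm z \<le> R \<Longrightarrow> norm (g z * lin_prod us z - 1) < \<delta> + \<eta> / 2"
    using product_pathD[OF assms(2), of "\<eta> / 2" S'] \<eta> by auto
  define M where "M = (\<Prod>a\<leftarrow>ys2. 1 + S' / norm a)"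
  have M: "norm (lin_prod us z) \<le> M" if "ys2 = us @ vs" "norm z \<le> S'" for us vs z
    using lin_prod_norm_le[OF that(2), of us vs] that(1) by (simp add: M_def)
  have M1: "M \<ge> 1" using M[of "[]" ys2 0] by (simp add: S'_def)
  have e: "\<eta> / (2 * M) > 0" "\<eta> / (2 * M) < \<eta>" using \<eta> M1 by (auto simp: field_simps)
  obtain ys1 where ys1: "0 \<notin> set ys1" "\<And>z. norm z \<le> S' \<Longrightarrow> norm (f z * lin_prod ys1 z - g z) < \<eta> / (2 * M)"
    "\<And>us vs z. ys1 = us @ vs \<Longrightarrow> norm z \<le> R \<Longrightarrow> norm (f z * lin_prod us z - 1) < \<delta> + \<eta> / (2 * M)"
    using product_pathD[OF assms(1) e(1), of S'] by auto
  have close: "norm (f z * lin_prod ys1 z * lin_prod us z - g z * lin_prod us z) \<le> \<eta> / 2"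
    if "ys2 = us @ vs" "norm z \<le> S'" for us vs z
  proof -
    have "norm (f z * lin_prod ys1 z - g z) * norm (lin_prod us z) \<le> \<eta> / (2 * M) * M"
      using ys1(2)[OF that(2)] M[OF that] e by (intro mult_mono) auto
    then show ?thesis using M1 by (simp add: norm_mult left_diff_distrib[symmetric])
  qed
  show "\<exists>ys. 0 \<notin> set ys \<and>
     (\<forall>z. norm z \<le> S \<longrightarrow> norm (f z * lin_prod ys z - h z) < \<eta>) \<and>
     (\<forall>us vs z. ys = us @ vs \<longrightarrow> norm z \<le> R \<longrightarrow> norm (f z * lin_prod us z - 1) < \<delta> + \<eta>)"
  proof (intro exI[of _ "ys1 @ ys2"] conjI allI impI)
    show "0 \<notin> set (ys1 @ ys2)" using ys1(1) ys2(1) by simp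
    show "norm (f z * lin_prod (ys1 @ ys2) z - h z) < \<eta>" if "norm z \<le> S" for z
    proof -
      have z: "norm z \<le> S'" using that by (simp add: S'_def)
      then have "norm ((f z * lin_prod ys1 z * lin_prod ys2 z - g z * lin_prod ys2 z) + (g z * lin_prod ys2 z - h z)) < \<eta>"
        using norm_triangle_ineq[of "f z * lin_prod ys1 z * lin_prod ys2 z - g z * lin_prod ys2 z" "g z * lin_prod ys2 z - h z"]
          close[of ys2 "[]" z] ys2(2)[of z] by simp
      then show ?thesis by (simp add: mult.assoc)
    qed
    show "norm (f z * lin_prod us z - 1) < \<delta> + \<eta>" if us: "ys1 @ ys2 = us @ vs" and z: "norm z \<le> R" for us vs z
    proof -
      have z': "norm z \<le> S'" using z by (simp add: S'_def)
      from us obtain ws where "ys1 = us @ ws \<or> us = ys1 @ ws \<and> ys2 = ws @ vs"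
        by (auto simp: append_eq_append_conv2)
      then show ?thesis
      proof (elim disjE conjE)
        assume "ys1 = us @ ws"
        then show ?thesis using ys1(3)[of us ws z] z e(2) by simp
      next
        assume *: "us = ys1 @ ws" "ys2 = ws @ vs"
        have "norm ((f z * lin_prod ys1 z * lin_prod ws z - g z * lin_prod ws z) + (g z * lin_prod ws z - 1)) < \<delta> + \<eta>"
          using norm_triangle_ineq[of "f z * lin_prod ys1 z * lin_prod ws z - g z * lin_prod ws z" "g z * lin_prod ws z - 1"]
            close[OF *(2) z'] ys2(3)[OF *(2) z] by linarith
        then show ?thesis using * by (simp add: mult.assoc)
      qed
    qed
  qed
qed

section \<open>Multiplication by the exponential of a polynomial in small steps\<close>

lemma prefix_concat_replicate:
  assumes "concat (replicate N xs) = us @ vs"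
  obtains k ws ws' where "us = concat (replicate k xs) @ ws" "xs = ws @ ws'" "k \<le> N"
  using assms
proof (induction N arbitrary: us thesis)
  case 0
  then show ?case using "0.prems"(1)[of 0 "[]" xs] by simp
next
  case (Suc N)
  then have "xs @ concat (replicate N xs) = us @ vs" by simp
  then obtain ws where "xs = us @ ws \<or> us = xs @ ws \<and> concat (replicate N xs) = ws @ vs"
    by (auto simp: append_eq_append_conv2)
  then show ?case
  proof (elim disjE conjE)
    assume "xs = us @ ws"
    then show ?case using Suc.prems(1)[of 0 us ws] by simp
  next
    assume *: "us = xs @ ws" "concat (replicate N xs) = ws @ vs"
    obtain k a b where "ws = concat (replicate k xs) @ a" "xs = a @ b" "k \<le> N"
      using Suc.IH[OF _ *(2)] by blast
    then show ?case using Suc.prems(1)[of "Suc k" a b] * by simp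
  qed
qed

lemma lin_prod_concat_replicate: "lin_prod (concat (replicate k xs)) z = lin_prod xs z ^ k"
  by (induction k) simp_all

lemma norm_power_diff_le:
  fixes a b :: complex
  assumes "norm a \<le> m" "norm b \<le> m" "m \<ge> 1"
  shows "norm (a ^ k - b ^ k) \<le> real k * norm (a - b) * m ^ k"
proof (induction k)
  case (Suc k)
  have "a ^ Suc k - b ^ Suc k = a * (a ^ k - b ^ k) + (a - b) * b ^ k" by (simp add: algebra_simps)
  also have "norm \<dots> \<le> norm a * norm (a ^ k - b ^ k) + norm (a - b) * norm b ^ k"
    by (metis norm_mult norm_power norm_triangle_ineq)
  also have "\<dots> \<le> m * (real k * norm (a - b) * m ^ k) + norm (a - b) * (m * m ^ k)"
  proof (intro add_mono mult_mono)
    have "norm b ^ k \<le> m ^ k" using assms by (intro power_mono) auto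
    also have "\<dots> \<le> m * m ^ k" using assms by (simp add: mult_le_cancel_right1)
    finally show "norm b ^ k \<le> m * m ^ k" .
  qed (use Suc assms in auto)
  also have "\<dots> = real (Suc k) * norm (a - b) * m ^ Suc k" by (simp add: algebra_simps)
  finally show ?case .
qed simp

text \<open>Each of at most \<open>N\<close> factors contributes an error of order
  \<open>(H / N)\<^sup>2\<close>, so the total is of order \<open>1 / N\<close>. It is uniform in
  \<open>k\<close>, as a prefix may stop after any number of copies.\<close>

lemma one_plus_power_exp:
  fixes w :: complex
  assumes "norm w \<le> H / real N" "H > 0" "real N \<ge> H" "k \<le> N"
  shows "norm ((1 + w) ^ k - exp (of_nat k * w)) \<le> 3 * H\<^sup>2 * exp H / real N"
    and "norm ((1 + w) ^ k) \<le> exp H"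
proof -
  have N: "real N > 0" using assms by linarith
  have "H / real N \<le> 1" using assms(3) N by simp
  then have w: "norm w \<le> 1" using assms(1) by linarith
  define m where "m = exp (norm w)"
  have "1 + norm w \<le> m" unfolding m_def by (rule exp_ge_add_one_self)
  then have m: "m \<ge> 1" "norm (1 + w) \<le> m" "norm (exp w) \<le> m"
    using norm_triangle_ineq[of 1 w] norm_exp[of w] norm_ge_zero[of w]
    unfolding m_def[symmetric] norm_one by linarith+
  have "real k * norm w \<le> real N * (H / real N)" using assms N by (intro mult_mono) auto
  then have kH: "real k * norm w \<le> H" using N by simp
  have mk: "m ^ k \<le> exp H" using kH by (simp add: m_def exp_of_nat_mult[symmetric])
  have "norm ((1 + w) ^ k) \<le> m ^ k" unfolding norm_power using m by (intro power_mono) auto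
  with mk show "norm ((1 + w) ^ k) \<le> exp H" by linarith
  have "norm ((1 + w) ^ k - exp (of_nat k * w)) = norm ((1 + w) ^ k - exp w ^ k)"
    by (simp add: exp_of_nat_mult)
  also have "\<dots> \<le> real k * norm ((1 + w) - exp w) * m ^ k"
    using m by (intro norm_power_diff_le) auto
  also have "\<dots> \<le> real N * (3 * (H / real N)\<^sup>2) * exp H"
  proof (intro mult_mono mk)
    have "norm ((1 + w) - exp w) = norm (exp w - 1 - w)" by (metis diff_diff_eq norm_minus_commute)
    also have "\<dots> \<le> 3 * norm w ^ 2" by (rule norm_exp_sub_le[OF w])
    also have "\<dots> \<le> 3 * (H / real N)\<^sup>2" using assms(1) by (intro mult_left_mono power_mono) auto
    finally show "norm ((1 + w) - exp w) \<le> 3 * (H / real N)\<^sup>2" .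
  qed (use assms N m in auto)
  also have "\<dots> = 3 * H\<^sup>2 * exp H / real N" using N by (simp add: power2_eq_square field_simps)
  finally show "norm ((1 + w) ^ k - exp (of_nat k * w)) \<le> 3 * H\<^sup>2 * exp H / real N" .
qed

text \<open>The factor \<open>exp h\<close> is approached through \<open>(1 + h / N) ^ k\<close>; for large \<open>N\<close> the roots of
  \<open>1 + h / N\<close> are far away, hence all partial products of its linear factors are close to \<open>1\<close>.\<close>

lemma product_path_exp_poly:
  fixes h :: "complex poly"
  assumes f: "continuous_on UNIV f" and h0: "poly h 0 = 0"
    and near: "\<And>t z. 0 \<le> t \<Longrightarrow> t \<le> 1 \<Longrightarrow> norm z \<le> R \<Longrightarrow>
      norm (f z * exp (of_real t * poly h z) - 1) \<le> \<delta>"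
  shows "product_path R \<delta> f (\<lambda>z. f z * exp (poly h z))"
  unfolding product_path_def
proof (intro allI impI)
  fix S \<eta> :: real assume \<eta>: "\<eta> > 0"
  define S' where "S' = max 0 (max S R)"
  obtain F where F: "F > 0" "\<And>z. norm z \<le> S' \<Longrightarrow> norm (f z) \<le> F"
    using entire_bounded_on_cball[OF f] by metis
  have hcont: "continuous_on UNIV (poly h)" by (intro continuous_intros)
  obtain H where H: "H > 0" "\<And>z. norm z \<le> S' \<Longrightarrow> norm (poly h z) \<le> H"
    using entire_bounded_on_cball[OF hcont] by metis
  \<comment> \<open>One third of \<eta> is for the incomplete last copy of \<open>bs\<close>,
    controlled by \<tau>; another third, controlled by \<open>N\<close>, for replacing
    \<open>(1 + h / N) ^ k\<close> by the exponential.\<close>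
  define \<tau> where "\<tau> = min 1 (\<eta> / (3 * F * exp H))"
  have \<tau>: "\<tau> > 0" "\<tau> \<le> 1" "F * (exp H * \<tau>) \<le> \<eta> / 3"
  proof -
    have "\<tau> \<le> \<eta> / (3 * F * exp H)" by (simp add: \<tau>_def)
    then show "F * (exp H * \<tau>) \<le> \<eta> / 3" using F by (simp add: field_simps)
    show "\<tau> > 0" using \<eta> F by (simp add: \<tau>_def)
    show "\<tau> \<le> 1" unfolding \<tau>_def by (rule min.cobounded1)
  qed
  define d where "d = degree h"
  \<comment> \<open>At most \<open>d\<close> zeros of modulus at least \<open>X\<close> make every
    partial product deviate from \<open>1\<close> by at most
    \<open>exp (d * S' / X) - 1 \<le> \<tau>\<close>. Since \<open>d\<close> does not depend on
    \<open>N\<close>, the choice of \<open>N\<close> can come later.\<close>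
  define X where "X = 2 * (real d + 1) * (S' + 1) / \<tau>"
  have X: "X > 0" "real d * (S' / X) \<le> \<tau> / 2"
  proof -
    have S'0: "S' \<ge> 0" by (simp add: S'_def)
    show "X > 0" using \<tau> S'0 by (simp add: X_def add_nonneg_pos)
    have "real d * S' \<le> (real d + 1) * (S' + 1)" using S'0 by (intro mult_mono) auto
    also have "\<dots> = \<tau> / 2 * X" using \<tau> by (simp add: X_def)
    finally show "real d * (S' / X) \<le> \<tau> / 2" using \<open>X > 0\<close> by (simp add: field_simps)
  qed
  obtain HX where HX: "HX > 0" "\<And>z. norm z \<le> X \<Longrightarrow> norm (poly h z) \<le> HX"
    using entire_bounded_on_cball[OF hcont] by metis
  \<comment> \<open>\<open>H\<close> is for \<open>one_plus_power_exp\<close>, \<open>HX\<close>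
    keeps zeros of \<open>1 + h / N\<close> out of the disc of radius \<open>X\<close>, and the last
    bound is for the other third of \<eta>.\<close>
  obtain N :: nat where N: "real N > max (max H HX) (9 * F * H\<^sup>2 * exp H / \<eta>)"
    using reals_Archimedean2 by blast
  then have N1: "real N > H" "real N > HX" "real N > 0" using H by auto
  have "9 * F * H\<^sup>2 * exp H / \<eta> < real N" using N by simp
  then have N2: "F * (3 * H\<^sup>2 * exp H / real N) \<le> \<eta> / 3"
    using \<eta> N1 by (simp add: field_simps)
  define p where "p = 1 + smult (1 / of_nat N) h"
  have p: "poly p z = 1 + poly h z / of_nat N" for z by (simp add: p_def)
  have degp: "degree p \<le> d"
    unfolding p_def d_def by (intro degree_add_le) (auto intro: order_trans[OF degree_smult_le])
  obtain bs where bs: "0 \<notin> set bs" "\<And>z. lin_prod bs z = poly p z" "length bs = degree p"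
    "\<And>b. b \<in> set bs \<Longrightarrow> poly p b = 0"
    using polynomial_eq_lin_prod[of p] h0 by (auto simp: p)
  have far: "X \<le> norm b" if "b \<in> set bs" for b
  proof (rule ccontr)
    assume "\<not> X \<le> norm b"
    then have "norm (poly h b) < real N" using HX(2)[of b] N1 by simp
    moreover have "poly h b = - of_nat N"
      using bs(4)[OF that] N1(3) by (simp add: p field_simps eq_neg_iff_add_eq_0 add.commute)
    ultimately show False by simp
  qed
  have pre: "norm (lin_prod ws z - 1) \<le> \<tau>" if "bs = ws @ ws'" "norm z \<le> S'" for ws ws' z
  proof -
    have S'X: "S' / X \<ge> 0" using X by (simp add: S'_def)
    have "norm (lin_prod ws z - 1) \<le> (1 + S' / X) ^ length ws - 1"
      using far that X by (intro lin_prod_minus_one_le) auto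
    also have "(1 + S' / X) ^ length ws \<le> (1 + S' / X) ^ d"
      using S'X bs(3) degp that(1) by (intro power_increasing) auto
    also have "(1 + S' / X) ^ d \<le> exp (S' / X) ^ d"
      using S'X exp_ge_add_one_self[of "S' / X"] by (intro power_mono) auto
    also have "\<dots> = exp (real d * (S' / X))" by (simp only: exp_of_nat_mult)
    also have "\<dots> \<le> exp (\<tau> / 2)" using X(2) by simp
    also have "\<dots> \<le> 1 + \<tau> / 2 + (\<tau> / 2)\<^sup>2" using \<tau> by (intro exp_bound) auto
    also have "(\<tau> / 2)\<^sup>2 \<le> \<tau> / 2"
      using \<tau> by (simp add: power2_eq_square mult_left_le)
    finally show ?thesis by simp
  qed
  \<comment> \<open>A prefix consists of \<open>k\<close> full copies of \<open>bs\<close> and a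
    part \<open>ws\<close> of the next. It is compared with \<open>exp (t * h)\<close> at
    \<open>t = k / N\<close>, which \<open>near\<close> controls.\<close>
  have key: "norm (f z * (lin_prod bs z ^ k * lin_prod ws z) - f z * exp (of_nat k / of_nat N * poly h z)) < \<eta>"
    if k: "k \<le> N" and ws: "bs = ws @ ws'" and z: "norm z \<le> S'" for k ws ws' z
  proof -
    define w where "w = poly h z / of_nat N"
    have w: "norm w \<le> H / real N" using H(2)[OF z] by (simp add: w_def norm_divide divide_right_mono)
    define a where "a = (1 + w) ^ k"
    have a: "norm (a - exp (of_nat k * w)) \<le> 3 * H\<^sup>2 * exp H / real N" "norm a \<le> exp H"
      unfolding a_def using one_plus_power_exp[OF w H(1) _ k] N1 by auto
    have eq: "f z * (a * lin_prod ws z) - f z * exp (of_nat k * w) =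
        f z * (a * (lin_prod ws z - 1)) + f z * (a - exp (of_nat k * w))"
      by (simp add: algebra_simps)
    have 1: "norm (f z * (a * (lin_prod ws z - 1))) \<le> F * (exp H * \<tau>)"
      unfolding norm_mult using F(2)[OF z] F(1) a(2) pre[OF ws z] by (intro mult_mono) auto
    have 2: "norm (f z * (a - exp (of_nat k * w))) \<le> F * (3 * H\<^sup>2 * exp H / real N)"
      unfolding norm_mult using F(2)[OF z] F(1) a(1) by (intro mult_mono) auto
    have "norm (f z * (a * lin_prod ws z) - f z * exp (of_nat k * w)) < \<eta>"
      unfolding eq using norm_triangle_ineq[of "f z * (a * (lin_prod ws z - 1))" "f z * (a - exp (of_nat k * w))"]
        1 2 \<tau>(3) N2 \<eta> by linarith
    then show ?thesis by (simp add: bs(2) p a_def w_def)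
  qed
  show "\<exists>ys. 0 \<notin> set ys \<and>
     (\<forall>z. norm z \<le> S \<longrightarrow> norm (f z * lin_prod ys z - f z * exp (poly h z)) < \<eta>) \<and>
     (\<forall>us vs z. ys = us @ vs \<longrightarrow> norm z \<le> R \<longrightarrow> norm (f z * lin_prod us z - 1) < \<delta> + \<eta>)"
  proof (intro exI[of _ "concat (replicate N bs)"] conjI allI impI)
    show "0 \<notin> set (concat (replicate N bs))" using bs(1) by auto
    show "norm (f z * lin_prod (concat (replicate N bs)) z - f z * exp (poly h z)) < \<eta>" if "norm z \<le> S" for z
      using key[of N "[]" bs z] that N1(3) by (simp add: lin_prod_concat_replicate S'_def)
    fix us vs and z :: complex assume us: "concat (replicate N bs) = us @ vs" and z: "norm z \<le> R"
    obtain k ws ws' where k: "us = concat (replicate k bs) @ ws" "bs = ws @ ws'" "k \<le> N"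
      using prefix_concat_replicate[OF us] by metis
    have z': "norm z \<le> S'" using z by (simp add: S'_def)
    let ?e = "f z * exp (of_nat k / of_nat N * poly h z)"
    have "norm (?e - 1) \<le> \<delta>"
      using near[of "real k / real N" z] k(3) N1(3) z by simp
    moreover have "norm (f z * lin_prod us z - ?e) < \<eta>"
      using key[OF k(3,2) z'] by (simp add: k(1) lin_prod_concat_replicate)
    ultimately show "norm (f z * lin_prod us z - 1) < \<delta> + \<eta>"
      using norm_triangle_ineq[of "f z * lin_prod us z - ?e" "?e - 1"] by simp
  qed
qed

text \<open>\<open>h\<close> minus the principal logarithm of \<open>exp h\<close> is continuous
  with values in the integer multiples of 2 pi i and vanishes at \<open>0\<close>. By connectedness
  \<open>h\<close> is the principal logarithm, to which \<open>norm_Ln_le\<close> applies.\<close>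

lemma norm_le_exp_minus_one:
  fixes h :: "complex \<Rightarrow> complex"
  assumes h: "continuous_on (cball 0 R) h" "h 0 = 0"
    and near: "\<And>z. norm z \<le> R \<Longrightarrow> norm (exp (h z) - 1) < 1/2" and z: "norm z \<le> R"
  shows "norm (h z) \<le> 2 * norm (exp (h z) - 1)"
proof -
  define k where "k x = h x - Ln (exp (h x))" for x :: complex
  have R: "R \<ge> 0" using z norm_ge_zero order_trans by blast
  have nonpos: "exp (h z) \<notin> \<real>\<^sub>\<le>\<^sub>0" if "norm z \<le> R" for z
  proof
    assume "exp (h z) \<in> \<real>\<^sub>\<le>\<^sub>0"
    then have "Re (exp (h z)) \<le> 0" by (simp add: complex_nonpos_Reals_iff)
    moreover have "\<bar>Re (exp (h z) - 1)\<bar> \<le> norm (exp (h z) - 1)" by (rule abs_Re_le_cmod)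
    ultimately show False using near[OF that] by simp
  qed
  have expk: "exp (k z) = 1" for z by (simp add: k_def exp_diff)
  have "k constant_on cball 0 R"
  proof (rule continuous_discrete_range_constant)
    show "continuous_on (cball 0 R) k"
      unfolding k_def using nonpos by (intro continuous_intros h) auto
    fix x :: complex assume "x \<in> cball 0 R"
    have "1 \<le> norm (k y - k x)" if "k y \<noteq> k x" for y
    proof -
      have "exp (k y - k x) = 1" using expk by (simp add: exp_diff)
      then obtain n :: int where n: "Re (k y - k x) = 0" "Im (k y - k x) = of_int (2 * n) * pi"
        unfolding exp_eq_1 by blast
      have "n \<noteq> 0" using n that by (auto simp: complex_eq_iff)
      then have "\<bar>of_int (2 * n)\<bar> \<ge> (1::real)" by linarith
      then have "1 * 1 \<le> \<bar>of_int (2 * n)\<bar> * pi" using pi_gt3 by (intro mult_mono) auto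
      then have "1 \<le> \<bar>Im (k y - k x)\<bar>" unfolding n(2) abs_mult by simp
      then show ?thesis using abs_Im_le_cmod order_trans by blast
    qed
    then show "\<exists>e>0. \<forall>y. y \<in> cball 0 R \<and> k y \<noteq> k x \<longrightarrow> e \<le> norm (k y - k x)"
      by (intro exI[of _ 1]) auto
  qed (rule connected_cball)
  moreover have "k 0 = 0" using h(2) by (simp add: k_def)
  ultimately have "k z = 0" using z R unfolding constant_on_def by (metis mem_cball_0 norm_zero)
  then have "h z = Ln (1 + (exp (h z) - 1))" by (simp add: k_def)
  then show ?thesis using norm_Ln_le[OF near[OF z]] by metis
qed

section \<open>Cancelling linear factors by exponentials\<close>

lemma norm_exp_minus_one_le:
  fixes w :: complex
  assumes "norm w \<le> 1"
  shows "norm (exp w - 1) \<le> 4 * norm w"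
proof -
  have "norm (exp w - 1) \<le> norm (exp w - 1 - w) + norm w"
    using norm_triangle_ineq[of "exp w - 1 - w" w] by simp
  also have "\<dots> \<le> 3 * norm w ^ 2 + norm w" using norm_exp_sub_le[OF assms] by simp
  also have "norm w ^ 2 \<le> norm w" using assms by (simp add: power2_eq_square mult_left_le)
  finally show ?thesis by simp
qed

lemma Ln_linear_factor_polynomial:
  assumes "R < norm b" "e > 0" "R \<ge> 0"
  obtains h :: "complex poly" where "poly h 0 = 0"
    "\<And>z. norm z \<le> R \<Longrightarrow> norm (Ln (1 - z / b) + poly h z) < e"
proof -
  have "1 - z / b \<notin> \<real>\<^sub>\<le>\<^sub>0" if "z \<in> ball 0 (norm b)" for z
  proof
    assume "1 - z / b \<in> \<real>\<^sub>\<le>\<^sub>0"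
    then have "Re (z / b) \<ge> 1" by (simp add: complex_nonpos_Reals_iff)
    then have "1 \<le> norm (z / b)" using complex_Re_le_cmod order_trans by blast
    moreover have "norm (z / b) < 1" using that by (auto simp: norm_divide divide_less_eq)
    ultimately show False by simp
  qed
  then have "(\<lambda>z. Ln (1 - z / b)) holomorphic_on ball 0 (norm b)"
    using assms by (intro holomorphic_intros) auto
  then obtain p where p: "\<And>z. z \<in> cball 0 R \<Longrightarrow> norm (Ln (1 - z / b) - poly p z) < e / 2"
    using polynomial_approximation[of _ "norm b" R "e / 2"] assms by auto
  show ?thesis
  \<comment> \<open>The shift makes the polynomial vanish at \<open>0\<close>; since
    \<open>Ln 1 = 0\<close>, it costs less than \<open>e / 2\<close>.\<close>
  proof (rule that[of "[:poly p 0:] - p"])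
    fix z :: complex assume z: "norm z \<le> R"
    have "norm (poly p 0) < e / 2" using p[of 0] assms by simp
    moreover have "norm (Ln (1 - z / b) - poly p z) < e / 2" using p[of z] z by simp
    ultimately show "norm (Ln (1 - z / b) + poly ([:poly p 0:] - p) z) < e"
      using norm_triangle_ineq[of "Ln (1 - z / b) - poly p z" "poly p 0"] by (simp add: algebra_simps)
  qed simp
qed

text \<open>Each linear factor is immediately compensated on the disc of radius \<open>R\<close> by an exponential
  approximating its inverse.\<close>

lemma product_path_compensated:
  assumes R: "R > 0" and \<eta>: "\<eta> > 0" "\<eta> \<le> 1/8" "8 * \<eta> \<le> \<delta>"
    and far: "\<And>b. b \<in> set bs \<Longrightarrow> norm b > 2 * R / \<eta>" and \<epsilon>: "\<epsilon> > 0" "\<epsilon> \<le> \<eta>"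
  shows "\<exists>h. poly h 0 = 0 \<and> product_path R \<delta> (\<lambda>z. 1) (\<lambda>z. lin_prod bs z * exp (poly h z)) \<and>
     (\<forall>z. norm z \<le> R \<longrightarrow> (\<exists>g. lin_prod bs z * exp (poly h z) = exp g \<and> norm g \<le> \<epsilon>))"
  using far \<epsilon>
\<comment> \<open>Half of the tolerance goes to the earlier factors and half to the new one, so the
  number of factors does not matter. The invariant bounds a logarithm \<open>g\<close> because
  logarithms of factors add.\<close>
proof (induction bs arbitrary: \<epsilon> rule: rev_induct)
  case Nil
  have "product_path R \<delta> (\<lambda>z. 1) (\<lambda>z. 1)" using \<eta> by (intro product_path_refl) auto
  then show ?case using Nil by (intro exI[of _ 0]) (auto intro!: exI[of _ 0])
next
  case (snoc b bs)
  have "\<epsilon> / 2 > 0" "\<epsilon> / 2 \<le> \<eta>" using snoc.prems by auto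
  then obtain h where h: "poly h 0 = 0" "product_path R \<delta> (\<lambda>z. 1) (\<lambda>z. lin_prod bs z * exp (poly h z))"
     "\<And>z. norm z \<le> R \<Longrightarrow> \<exists>g. lin_prod bs z * exp (poly h z) = exp g \<and> norm g \<le> \<epsilon> / 2"
    using snoc.IH[of "\<epsilon> / 2"] snoc.prems(1) by auto
  define f where "f z = lin_prod bs z * exp (poly h z)" for z
  have b: "norm b > 2 * R / \<eta>" using snoc.prems(1) by simp
  have "2 * R / \<eta> \<ge> 2 * R" using R \<eta> by (simp add: field_simps)
  then have bR: "norm b > R" "b \<noteq> 0" using b R by auto
  obtain h1 where h1: "poly h1 0 = 0" "\<And>z. norm z \<le> R \<Longrightarrow> norm (Ln (1 - z / b) + poly h1 z) < \<epsilon> / 2"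
    using Ln_linear_factor_polynomial[OF bR(1) \<open>\<epsilon> / 2 > 0\<close>] R by auto
  \<comment> \<open>The \<open>2\<close> in \<open>far\<close> yields \<open>\<eta> / 2\<close>,
    which \<open>norm_Ln_le\<close> doubles to \<eta>.\<close>
  have small: "norm (z / b) \<le> \<eta> / 2" if "norm z \<le> R" for z :: complex
  proof -
    have "norm z * 2 \<le> norm b * \<eta>" using b that \<eta> by (simp add: field_simps)
    then show ?thesis using bR by (simp add: norm_divide field_simps)
  qed
  have Ln: "norm (Ln (1 - z / b)) \<le> \<eta>" "exp (Ln (1 - z / b)) = 1 - z / b" if "norm z \<le> R" for z :: complex
  proof -
    show "norm (Ln (1 - z / b)) \<le> \<eta>"
      using norm_Ln_le[of "- (z / b)"] small[OF that] \<eta> by simp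
    have "z / b \<noteq> 1" using small[OF that] \<eta> by auto
    then have "1 - z / b \<noteq> 0" by simp
    then show "exp (Ln (1 - z / b)) = 1 - z / b" by (rule exp_Ln)
  qed
  \<comment> \<open>Logarithms along the path stay within \<open>2 * \<eta>\<close>, and the
    exponential costs a factor \<open>4\<close>: hence the assumption
    \<open>8 * \<eta> \<le> \<delta>\<close>.\<close>
  have exp_near: "norm (exp g - 1) \<le> \<delta>" if "norm g \<le> 2 * \<eta>" for g :: complex
    using norm_exp_minus_one_le[of g] that \<eta> by simp
  have t: "norm (f z * (1 - z / b) * exp (of_real t * poly h1 z) - 1) \<le> \<delta>"
    if z: "norm z \<le> R" and t: "0 \<le> t" "t \<le> 1" for z t
  proof -
    obtain g where g: "f z = exp g" "norm g \<le> \<epsilon> / 2" using h(3)[OF z] by (auto simp: f_def)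
    let ?L = "Ln (1 - z / b)"
    \<comment> \<open>\<open>?L + t * h1\<close> is a convex combination of \<open>?L\<close> and
      \<open>?L + h1\<close>, both of norm at most \<eta>. The value \<open>t = 0\<close> is the
      factor before compensation.\<close>
    have "norm (of_real (1 - t) * ?L + of_real t * (?L + poly h1 z)) \<le> (1 - t) * \<eta> + t * \<eta>"
    proof (rule norm_triangle_mono)
      show "norm (of_real (1 - t) * ?L) \<le> (1 - t) * \<eta>"
        unfolding norm_mult norm_of_real using t Ln(1)[OF z] by (intro mult_mono) auto
      show "norm (of_real t * (?L + poly h1 z)) \<le> t * \<eta>"
        unfolding norm_mult norm_of_real using t h1(2)[OF z] snoc.prems by (intro mult_mono) auto
    qed
    then have "norm (?L + of_real t * poly h1 z) \<le> \<eta>" by (simp add: algebra_simps)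
    then have "norm (g + (?L + of_real t * poly h1 z)) \<le> 2 * \<eta>"
      using norm_triangle_ineq[of g "?L + of_real t * poly h1 z"] g snoc.prems by linarith
    moreover have "f z * (1 - z / b) * exp (of_real t * poly h1 z) = exp (g + (?L + of_real t * poly h1 z))"
      by (simp only: exp_add g Ln(2)[OF z] mult.assoc)
    ultimately show ?thesis using exp_near by simp
  qed
  have f1: "norm (f z - 1) \<le> \<delta>" if z: "norm z \<le> R" for z
    using h(3)[OF z] exp_near snoc.prems by (force simp: f_def)
  have cont: "continuous_on UNIV (\<lambda>z. f z * (1 - z / b))"
  proof -
    have "continuous_on UNIV (lin_prod xs)" if "0 \<notin> set xs" for xs
      using that by (induction xs) (auto intro!: continuous_intros simp: lin_prod_def)
    moreover have "0 \<notin> set bs" using snoc.prems(1)[of 0] R \<eta> by (auto simp: divide_less_0_iff)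
    ultimately show ?thesis unfolding f_def using bR by (intro continuous_intros) auto
  qed
  have "product_path R \<delta> f (\<lambda>z. f z * (1 - z / b))"
    using product_path_linear_factor[OF bR(2), of R f \<delta>] f1 t[of _ 0] by simp
  moreover have "product_path R \<delta> (\<lambda>z. f z * (1 - z / b)) (\<lambda>z. f z * (1 - z / b) * exp (poly h1 z))"
    using product_path_exp_poly[OF cont h1(1) t] by simp
  ultimately have "product_path R \<delta> (\<lambda>z. 1) (\<lambda>z. f z * (1 - z / b) * exp (poly h1 z))"
    using h(2) product_path_trans unfolding f_def[symmetric] by blast
  moreover have eq: "f z * (1 - z / b) * exp (poly h1 z) = lin_prod (bs @ [b]) z * exp (poly (h + h1) z)" for z
    by (simp add: f_def exp_add mult_ac)
  moreover have "\<exists>g. lin_prod (bs @ [b]) z * exp (poly (h + h1) z) = exp g \<and> norm g \<le> \<epsilon>" if z: "norm z \<le> R" for z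
  proof -
    obtain g where g: "f z = exp g" "norm g \<le> \<epsilon> / 2" using h(3)[OF z] by (auto simp: f_def)
    have "norm (g + (Ln (1 - z / b) + poly h1 z)) \<le> \<epsilon>"
      using norm_triangle_ineq[of g "Ln (1 - z / b) + poly h1 z"] g h1(2)[OF z] by simp
    moreover have "exp (g + (Ln (1 - z / b) + poly h1 z)) = f z * (1 - z / b) * exp (poly h1 z)"
      by (simp only: exp_add g Ln(2)[OF z] mult.assoc)
    ultimately show ?thesis using eq by metis
  qed
  ultimately show ?case using h(1) h1(1) by (intro exI[of _ "h + h1"]) simp
qed

text \<open>\<open>S\<close> and \<open>e\<close> depend on \<open>R\<close> and \<delta> alone, not
  on the degree of \<open>q\<close>. As \<open>q\<close> and \<open>q * exp h\<close> are both near
  \<open>1\<close> on the disc of radius \<open>R\<close>, so is \<open>exp h\<close>; then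
  \<open>h\<close> itself is small there and can be removed without leaving the neighbourhood of
  \<open>1\<close>.\<close>

lemma product_path_to_polynomial:
  assumes R: "R > 0" and \<delta>: "\<delta> > 0"
  obtains S e where "S \<ge> 0" "e > 0"
    "\<And>q. poly q 0 = 1 \<Longrightarrow> (\<And>z. norm z \<le> S \<Longrightarrow> norm (poly q z - 1) < e) \<Longrightarrow> product_path R \<delta> (\<lambda>z. 1) (poly q)"
proof -
  \<comment> \<open>In units of \<eta> the bounds below are \<open>10\<close> for
    \<open>exp h - 1\<close>, \<open>20\<close> for \<open>h\<close>, \<open>80\<close> for
    \<open>exp ((1 - t) * h) - 1\<close>, \<open>160\<close> after multiplying by \<open>q\<close>,
    and \<open>161\<close> in total.\<close>
  define \<eta> where "\<eta> = min (1/200) (\<delta> / 200)"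
  have "\<eta> \<le> \<delta> / 200" by (simp add: \<eta>_def)
  then have \<eta>: "\<eta> > 0" "\<eta> \<le> 1/200" "200 * \<eta> \<le> \<delta>" using \<delta> by (auto simp: \<eta>_def)
  \<comment> \<open>\<open>2 * R / \<eta>\<close> is the distance that
    \<open>product_path_compensated\<close> demands of the zeros; no zero is closer, as
    \<open>q\<close> is within \<eta> of \<open>1\<close> there.\<close>
  define S where "S = R + 2 * R / \<eta>"
  have S: "S \<ge> R" "S \<ge> 2 * R / \<eta>" using R \<eta> by (auto simp: S_def)
  show ?thesis
  proof (rule that[of S \<eta>])
    fix q :: "complex poly"
    assume q0: "poly q 0 = 1" and q: "\<And>z. norm z \<le> S \<Longrightarrow> norm (poly q z - 1) < \<eta>"
    obtain bs where bs: "0 \<notin> set bs" "\<And>z. lin_prod bs z = poly q z"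
      "\<And>b. b \<in> set bs \<Longrightarrow> poly q b = 0"
      using polynomial_eq_lin_prod[OF q0] by metis
    have far: "norm b > 2 * R / \<eta>" if "b \<in> set bs" for b
    proof (rule ccontr)
      assume "\<not> norm b > 2 * R / \<eta>"
      then have "norm (poly q b - 1) < \<eta>" using S by (intro q) simp
      then show False using bs(3)[OF that] \<eta> by simp
    qed
    obtain h where h: "poly h 0 = 0" "product_path R \<delta> (\<lambda>z. 1) (\<lambda>z. lin_prod bs z * exp (poly h z))"
     "\<And>z. norm z \<le> R \<Longrightarrow> \<exists>g. lin_prod bs z * exp (poly h z) = exp g \<and> norm g \<le> \<eta>"
      using product_path_compensated[OF R \<eta>(1), of \<delta> bs \<eta>] \<eta> far by auto
    have q1: "norm (poly q z - 1) < \<eta>" if "norm z \<le> R" for z using q[of z] that S by simp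
    have q2: "norm (poly q z) \<ge> 1/2" if "norm z \<le> R" for z
      using norm_triangle_ineq2[of 1 "1 - poly q z"] q1[OF that] \<eta> by (simp add: norm_minus_commute)
    have exph: "norm (exp (poly h z) - 1) \<le> 10 * \<eta>" if z: "norm z \<le> R" for z
    proof -
      obtain g where g: "poly q z * exp (poly h z) = exp g" "norm g \<le> \<eta>" using h(3)[OF z] bs(2) by auto
      have qz: "poly q z \<noteq> 0" using q2[OF z] by auto
      have "norm (exp g - 1) \<le> 4 * \<eta>" using norm_exp_minus_one_le[of g] g \<eta> by simp
      then have "norm (exp g - poly q z) \<le> 5 * \<eta>"
        using norm_triangle_ineq4[of "exp g - 1" "poly q z - 1"] q1[OF z] by simp
      moreover have "exp (poly h z) - 1 = (exp g - poly q z) / poly q z"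
        using qz g(1) by (simp add: field_simps)
      ultimately have "norm (exp (poly h z) - 1) = norm (exp g - poly q z) / norm (poly q z)"
        "norm (exp g - poly q z) \<le> 5 * \<eta>" by (simp_all add: norm_divide)
      moreover have "norm (exp g - poly q z) / norm (poly q z) \<le> 5 * \<eta> / (1/2)"
        using calculation(2) q2[OF z] \<eta> by (intro frac_le) auto
      ultimately show ?thesis by simp
    qed
    have hsmall: "norm (poly h z) \<le> 20 * \<eta>" if z: "norm z \<le> R" for z
    proof -
      have "norm (poly h z) \<le> 2 * norm (exp (poly h z) - 1)"
      proof (rule norm_le_exp_minus_one[where h = "poly h" and R = R, OF _ h(1) _ z])
        show "norm (exp (poly h y) - 1) < 1 / 2" if "norm y \<le> R" for y
          using exph[OF that] \<eta> by simp
      qed (intro continuous_intros)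
      then show ?thesis using exph[OF z] by simp
    qed
    have "product_path R \<delta> (\<lambda>z. poly q z * exp (poly h z)) (\<lambda>z. poly q z * exp (poly h z) * exp (poly (- h) z))"
    proof (rule product_path_exp_poly)
      fix t :: real and z :: complex
      assume t: "0 \<le> t" "t \<le> 1" and z: "norm z \<le> R"
      have "norm (of_real (1 - t) * poly h z) \<le> 1 * (20 * \<eta>)"
        unfolding norm_mult norm_of_real using t hsmall[OF z] by (intro mult_mono) auto
      then have e: "norm (exp (of_real (1 - t) * poly h z) - 1) \<le> 80 * \<eta>"
        using norm_exp_minus_one_le[of "of_real (1 - t) * poly h z"] \<eta> by simp
      have "norm (poly q z) \<le> 2"
        using norm_triangle_ineq[of 1 "poly q z - 1"] q1[OF z] \<eta> by simp
      then have "norm (poly q z * (exp (of_real (1 - t) * poly h z) - 1)) \<le> 2 * (80 * \<eta>)"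
        unfolding norm_mult using e \<eta> by (intro mult_mono) auto
      then have "norm (poly q z * (exp (of_real (1 - t) * poly h z) - 1) + (poly q z - 1)) \<le> \<delta>"
        using norm_triangle_ineq[of "poly q z * (exp (of_real (1 - t) * poly h z) - 1)" "poly q z - 1"]
          q1[OF z] \<eta> by linarith
      moreover have "poly q z * exp (poly h z) * exp (of_real t * poly (- h) z) - 1
          = poly q z * (exp (of_real (1 - t) * poly h z) - 1) + (poly q z - 1)"
        by (simp add: algebra_simps exp_diff exp_minus field_simps)
      ultimately show "norm (poly q z * exp (poly h z) * exp (of_real t * poly (- h) z) - 1) \<le> \<delta>"
        by (simp only:)
    qed (use h(1) in \<open>auto intro!: continuous_intros\<close>)
    moreover have "(\<lambda>z. poly q z * exp (poly h z) * exp (poly (- h) z)) = poly q"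
      by (rule ext) (simp add: mult.assoc exp_add[symmetric])
    ultimately have "product_path R \<delta> (\<lambda>z. poly q z * exp (poly h z)) (poly q)" by (simp only:)
    then show "product_path R \<delta> (\<lambda>z. 1) (poly q)"
      using product_path_trans h(2) by (simp only: bs(2))
  qed (use R S \<eta> in auto)
qed

section \<open>Construction of the infinite product\<close>

lemma lin_prod_is_poly:
  obtains p where "poly p = lin_prod xs" "p \<noteq> 0"
proof -
  have "\<exists>p. poly p = lin_prod xs"
  proof (induction xs)
    case Nil
    show ?case by (intro exI[of _ 1]) auto
  next
    case (Cons a xs)
    then obtain p where p: "poly p = lin_prod xs" by blast
    show ?case
      by (intro exI[of _ "[:1, - inverse a:] * p"] ext) (simp add: p divide_inverse algebra_simps)
  qed
  then obtain p where p: "poly p = lin_prod xs" by blast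
  moreover have "lin_prod xs 0 = 1" by (induction xs) simp_all
  then have "p \<noteq> 0" using p by (metis poly_0 zero_neq_one)
  ultimately show ?thesis using that by blast
qed

lemma lin_prod_holomorphic: "lin_prod xs holomorphic_on S"
  by (metis lin_prod_is_poly poly_holomorphic)

text \<open>Taylor polynomials with coefficients moved into a countable dense set.\<close>

lemma countable_dense_in_entire:
  obtains D :: "nat \<Rightarrow> complex poly" where
    "\<And>u r e. u holomorphic_on UNIV \<Longrightarrow> e > 0 \<Longrightarrow> \<exists>i. \<forall>z. norm z \<le> r \<longrightarrow> norm (poly (D i) z - u z) < e"
proof -
  obtain C :: "complex set" where C: "countable C" "\<And>X. open X \<Longrightarrow> X \<noteq> {} \<Longrightarrow> \<exists>d\<in>C. d \<in> X"
    using countable_dense_setE by metis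
  define P where "P = Poly ` lists C"
  have P: "countable P" using C(1) by (auto simp: P_def)
  show ?thesis
  proof (rule that[of "from_nat_into P"])
    fix u :: "complex \<Rightarrow> complex" and r e :: real
    assume u: "u holomorphic_on UNIV" and e: "e > 0"
    obtain p where p: "\<And>z. z \<in> cball 0 r \<Longrightarrow> norm (u z - poly p z) < e / 2"
      using polynomial_approximation[OF holomorphic_on_subset[OF u], of "r + 1" r "e / 2"] e by auto
    define d where "d = degree p"
    define m where "m = max 1 r"
    have m: "m \<ge> 1" by (simp add: m_def)
    \<comment> \<open>There are \<open>d + 1\<close> coefficients to move, each multiplied by at
      most \<open>m ^ d\<close>; \<open>m \<ge> 1\<close> makes the powers increase.\<close>
    define W where "W = (real d + 1) * m ^ d"
    have W: "W > 0" using m by (auto simp: W_def intro!: mult_pos_pos)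
    define \<theta> where "\<theta> = e / (2 * W)"
    have \<theta>: "\<theta> > 0" using e W by (simp add: \<theta>_def)
    have "\<exists>d\<in>C. d \<in> ball (coeff p i) \<theta>" for i
      using C(2)[of "ball (coeff p i) \<theta>"] \<theta> by auto
    then obtain c where c: "\<And>i. c i \<in> C" "\<And>i. norm (coeff p i - c i) < \<theta>"
      by (metis mem_ball dist_norm)
    define q where "q = Poly (map c [0..<Suc d])"
    have "q \<in> P" unfolding P_def q_def using c(1) by (intro imageI) auto
    then obtain i where i: "from_nat_into P i = q" using from_nat_into_surj[OF P] by blast
    have coeffq: "coeff q i = (if i \<le> d then c i else 0)" for i
      by (simp add: q_def nth_default_def less_Suc_eq_le del: upt_Suc)
    have qz: "poly q z = (\<Sum>i\<le>d. c i * z ^ i)" for z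
    proof -
      have "degree q \<le> d" by (intro degree_le) (simp add: coeffq)
      then have "poly q z = (\<Sum>i\<le>d. coeff q i * z ^ i)"
        unfolding poly_altdef by (intro sum.mono_neutral_left) (auto simp: coeff_eq_0)
      then show ?thesis by (simp add: coeffq)
    qed
    have "norm (poly q z - u z) < e" if z: "norm z \<le> r" for z
    proof -
      have "poly p z - poly q z = (\<Sum>i\<le>d. (coeff p i - c i) * z ^ i)"
        by (simp add: qz poly_altdef[of p] d_def sum_subtractf left_diff_distrib)
      also have "norm \<dots> \<le> (\<Sum>i\<le>d. \<theta> * m ^ d)"
      proof (rule sum_norm_le)
        fix i assume i: "i \<in> {..d}"
        have "norm z ^ i \<le> m ^ i" using z by (intro power_mono) (auto simp: m_def)
        also have "\<dots> \<le> m ^ d" using m i by (intro power_increasing) auto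
        finally show "norm ((coeff p i - c i) * z ^ i) \<le> \<theta> * m ^ d"
          unfolding norm_mult norm_power using c(2)[of i] \<theta> by (intro mult_mono) auto
      qed
      also have "\<dots> = W * \<theta>" by (simp add: W_def algebra_simps)
      also have "\<dots> = e / 2" using W by (simp add: \<theta>_def)
      finally have "norm (poly p z - poly q z) \<le> e / 2" .
      moreover have "norm (u z - poly p z) < e / 2" using p z by simp
      ultimately show ?thesis
        using norm_triangle_ineq[of "u z - poly p z" "poly p z - poly q z"] by (simp add: norm_minus_commute)
    qed
    then show "\<exists>i. \<forall>z. norm z \<le> r \<longrightarrow> norm (poly (from_nat_into P i) z - u z) < e" using i by blast
  qed
qed

section \<open>One block of linear factors, and the sequence of blocks\<close>

locale splitting_exp_coeffs = exp_coeffs +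
  fixes \<Lambda>1 \<Lambda>2 :: "complex set"
  assumes \<Lambda>1: "open \<Lambda>1" "\<Lambda>1 \<noteq> {}" "\<And>l. l \<in> \<Lambda>1 \<Longrightarrow> norm (taylor l 0) < 1"
    and \<Lambda>2: "open \<Lambda>2" "\<Lambda>2 \<noteq> {}" "\<And>l. l \<in> \<Lambda>2 \<Longrightarrow> norm (taylor l 0) > 1 \<and> taylor l 1 \<noteq> 0"
begin

text \<open>The prefix estimate rests on \<delta>, but \<open>n\<close> is known only after
  \<open>q\<close>. \<open>product_path\<close> allows the accuracy \<eta>, and the radius
  \<open>S2\<close> on which it holds, to be prescribed after that.\<close>

lemma extend_possibly_empty:
  assumes g: "g holomorphic_on UNIV" and R: "R > 0" and \<epsilon>: "\<epsilon> > 0"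
  obtains ys n where "n \<ge> 1" "0 \<notin> set ys"
    "\<And>us vs z. ys = us @ vs \<Longrightarrow> norm z \<le> R \<Longrightarrow> norm (lin_prod (xs @ us) z - lin_prod xs z) < \<epsilon>"
    "\<And>z. norm z \<le> R \<Longrightarrow> norm ((T ^^ n) (lin_prod (xs @ ys)) z - g z) < \<epsilon>"
proof -
  obtain p where p: "poly p = lin_prod xs" "p \<noteq> 0" by (rule lin_prod_is_poly)
  have cont: "continuous_on UNIV (poly p)" by (intro continuous_intros)
  obtain M where M: "M > 0" "\<And>z. norm z \<le> R \<Longrightarrow> norm (poly p z) \<le> M"
    using entire_bounded_on_cball[OF cont] by metis
  \<comment> \<open>Prefixes deviate from \<open>1\<close> by less than
    \<open>\<delta> + \<eta> \<le> 2 * \<delta>\<close>; multiplication by \<open>p\<close> makes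
    this at most \<open>\<epsilon> / 2\<close>.\<close>
  define \<delta> where "\<delta> = \<epsilon> / (4 * M)"
  have \<delta>: "\<delta> > 0" "M * (2 * \<delta>) = \<epsilon> / 2" using \<epsilon> M by (auto simp: \<delta>_def)
  obtain S e where S: "S \<ge> 0" "e > 0"
    "\<And>q. poly q 0 = 1 \<Longrightarrow> (\<And>z. norm z \<le> S \<Longrightarrow> norm (poly q z - 1) < e) \<Longrightarrow> product_path R \<delta> (\<lambda>z. 1) (poly q)"
    using product_path_to_polynomial[OF R \<delta>(1)] by metis
  have e': "min e (\<epsilon> / 2) > 0" using S \<epsilon> by simp
  obtain q n where q: "n \<ge> 1" "poly q 0 = 1"
    "\<And>z. norm z \<le> S \<Longrightarrow> norm (poly q z - 1) < min e (\<epsilon> / 2)"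
    "\<And>z. norm z \<le> R \<Longrightarrow> norm ((T ^^ n) (\<lambda>z. poly p z * poly q z) z - g z) < min e (\<epsilon> / 2)"
    using step_polynomial[OF \<Lambda>1 \<Lambda>2 p(2) g S(1) less_imp_le[OF R] e'] by metis
  have path: "product_path R \<delta> (\<lambda>z. 1) (poly q)"
    using q(3) by (intro S(3) q(2)) simp
  define S2 where "S2 = R + real n * (2 * B)"
  obtain M2 where M2: "M2 > 0" "\<And>z. norm z \<le> S2 \<Longrightarrow> norm (poly p z) \<le> M2"
    using entire_bounded_on_cball[OF cont] by metis
  have pos: "(2 * A) ^ n * M2 > 0" using A M2 by simp
  define \<eta> where "\<eta> = min \<delta> (\<epsilon> / (4 * ((2 * A) ^ n * M2)))"
  have \<eta>: "\<eta> > 0" "\<eta> \<le> \<delta>" "(2 * A) ^ n * (M2 * \<eta>) \<le> \<epsilon> / 4"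
  proof -
    show "\<eta> > 0" "\<eta> \<le> \<delta>" using \<delta> \<epsilon> pos by (simp_all add: \<eta>_def)
    have "\<eta> \<le> \<epsilon> / (4 * ((2 * A) ^ n * M2))" by (simp add: \<eta>_def)
    then show "(2 * A) ^ n * (M2 * \<eta>) \<le> \<epsilon> / 4" using pos by (simp add: field_simps)
  qed
  obtain ys where ys: "0 \<notin> set ys" "\<And>z. norm z \<le> S2 \<Longrightarrow> norm (1 * lin_prod ys z - poly q z) < \<eta>"
    "\<And>us vs z. ys = us @ vs \<Longrightarrow> norm z \<le> R \<Longrightarrow> norm (1 * lin_prod us z - 1) < \<delta> + \<eta>"
    using product_pathD[OF path \<eta>(1), of S2] by metis
  show ?thesis
  proof (rule that[OF q(1) ys(1)])
    fix us vs and z :: complex assume us: "ys = us @ vs" and z: "norm z \<le> R"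
    have "norm (lin_prod us z - 1) \<le> 2 * \<delta>" using ys(3)[OF us z] \<eta>(2) by simp
    then have "norm (poly p z) * norm (lin_prod us z - 1) \<le> M * (2 * \<delta>)"
      using M(2)[OF z] M(1) by (intro mult_mono) auto
    also have "\<dots> < \<epsilon>" using \<delta>(2) \<epsilon> by simp
    also have "norm (poly p z) * norm (lin_prod us z - 1) = norm (lin_prod (xs @ us) z - lin_prod xs z)"
      unfolding norm_mult[symmetric] by (simp add: p(1) right_diff_distrib)
    finally show "norm (lin_prod (xs @ us) z - lin_prod xs z) < \<epsilon>" .
  next
    fix z :: complex assume z: "norm z \<le> R"
    have "norm ((T ^^ n) (lin_prod (xs @ ys)) z - (T ^^ n) (\<lambda>z. poly p z * poly q z) z) \<le> (2 * A) ^ n * (M2 * \<eta>)"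
    proof (rule T_pow_diff_bound[OF lin_prod_holomorphic _ _ z])
      show "(\<lambda>z. poly p z * poly q z) holomorphic_on UNIV"
        by (intro holomorphic_intros poly_holomorphic)
      fix w :: complex assume "norm w \<le> R + real n * (2 * B)"
      then have w: "norm w \<le> S2" by (simp add: S2_def)
      have "norm (poly p w) * norm (lin_prod ys w - poly q w) \<le> M2 * \<eta>"
        using ys(2)[OF w] M2(2)[OF w] M2(1) by (intro mult_mono) auto
      then show "norm (lin_prod (xs @ ys) w - poly p w * poly q w) \<le> M2 * \<eta>"
        unfolding norm_mult[symmetric] by (simp add: p(1) right_diff_distrib)
    qed
    moreover have "norm ((T ^^ n) (\<lambda>z. poly p z * poly q z) z - g z) < \<epsilon> / 2" using q(4)[OF z] by simp
    ultimately show "norm ((T ^^ n) (lin_prod (xs @ ys)) z - g z) < \<epsilon>"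
      using \<eta>(3) \<epsilon> norm_triangle_ineq[of "(T ^^ n) (lin_prod (xs @ ys)) z - (T ^^ n) (\<lambda>z. poly p z * poly q z) z"
          "(T ^^ n) (\<lambda>z. poly p z * poly q z) z - g z"] by simp
  qed
qed

text \<open>A nonempty block ensures that the product has infinitely many factors. One factor with a
  remote zero is put in front, and the target is met with it already in place.\<close>

lemma extend:
  assumes g: "g holomorphic_on UNIV" and R: "R > 0" and \<epsilon>: "\<epsilon> > 0"
  obtains ys n where "n \<ge> 1" "ys \<noteq> []" "0 \<notin> set ys"
    "\<And>us vs z. ys = us @ vs \<Longrightarrow> norm z \<le> R \<Longrightarrow> norm (lin_prod (xs @ us) z - lin_prod xs z) < \<epsilon>"
    "\<And>z. norm z \<le> R \<Longrightarrow> norm ((T ^^ n) (lin_prod (xs @ ys)) z - g z) < \<epsilon>"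
proof -
  have cont: "continuous_on UNIV (lin_prod xs)"
    using lin_prod_holomorphic by (rule holomorphic_on_imp_continuous_on)
  obtain M where M: "M > 0" "\<And>z. norm z \<le> R \<Longrightarrow> norm (lin_prod xs z) \<le> M"
    using entire_bounded_on_cball[OF cont] by metis
  \<comment> \<open>Solves \<open>M * (R / \<beta>) = \<epsilon> / 2\<close>, a bound for the change
    caused by the factor \<open>1 - z / b\<close>.\<close>
  define \<beta> where "\<beta> = 2 * M * R / \<epsilon>"
  have \<beta>: "\<beta> > 0" using M R \<epsilon> by (simp add: \<beta>_def)
  define b where "b = complex_of_real \<beta>"
  have b: "norm b = \<beta>" "b \<noteq> 0" using \<beta> by (auto simp: b_def)
  have first: "norm (lin_prod (xs @ [b]) z - lin_prod xs z) \<le> \<epsilon> / 2" if z: "norm z \<le> R" for z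
  proof -
    have "norm (lin_prod xs z) * (norm z / norm b) \<le> M * (R / \<beta>)"
      unfolding b(1) using M(2)[OF z] M(1) z \<beta> by (intro mult_mono divide_right_mono) auto
    also have "\<dots> = \<epsilon> / 2" using M(1) R \<epsilon> by (simp add: \<beta>_def field_simps)
    finally have "norm (lin_prod xs z * (z / b)) \<le> \<epsilon> / 2" by (simp add: norm_mult norm_divide)
    moreover have "lin_prod (xs @ [b]) z - lin_prod xs z = - (lin_prod xs z * (z / b))"
      by (simp add: algebra_simps)
    ultimately show ?thesis by (simp only: norm_minus_cancel)
  qed
  obtain ys n where ys: "n \<ge> 1" "0 \<notin> set ys"
    "\<And>us vs z. ys = us @ vs \<Longrightarrow> norm z \<le> R \<Longrightarrow>
        norm (lin_prod ((xs @ [b]) @ us) z - lin_prod (xs @ [b]) z) < \<epsilon> / 2"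
    "\<And>z. norm z \<le> R \<Longrightarrow> norm ((T ^^ n) (lin_prod ((xs @ [b]) @ ys)) z - g z) < \<epsilon> / 2"
    using extend_possibly_empty[OF g R half_gt_zero[OF \<epsilon>], of "xs @ [b]"] by metis
  show ?thesis
  proof (rule that[OF ys(1), of "b # ys"])
    fix us vs and z :: complex assume us: "b # ys = us @ vs" and z: "norm z \<le> R"
    show "norm (lin_prod (xs @ us) z - lin_prod xs z) < \<epsilon>"
    proof (cases us)
      case Nil
      then show ?thesis using \<epsilon> by simp
    next
      case (Cons b' us')
      then have "b' = b" "ys = us' @ vs" using us by auto
      from ys(3)[OF this(2) z] this(1) Cons first[OF z] show ?thesis
        using norm_triangle_ineq[of "lin_prod ((xs @ [b]) @ us') z - lin_prod (xs @ [b]) z"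
            "lin_prod (xs @ [b]) z - lin_prod xs z"] by (simp add: mult.assoc)
    qed
  next
    fix z :: complex assume "norm z \<le> R"
    from ys(4)[OF this] \<epsilon> show "norm ((T ^^ n) (lin_prod (xs @ b # ys)) z - g z) < \<epsilon>" by simp
  qed (use ys(2) b in auto)
qed

text \<open>Radii grow by what \<open>n k\<close> applications of \<open>T\<close> cost. The
  tolerances at least halve, so all blocks from \<open>Suc k\<close> on change the product by at
  most \<open>2 * \<epsilon> (Suc k)\<close>, which \<open>T ^^ n k\<close> magnifies to at most
  \<open>\<epsilon> k\<close> by the last equation.\<close>

lemma block_sequence:
  assumes G: "\<And>k. G k holomorphic_on UNIV"
  obtains X :: "nat \<Rightarrow> complex list" and n :: "nat \<Rightarrow> nat" and R \<epsilon> :: "nat \<Rightarrow> real" where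
    "\<And>k. 0 \<notin> set (X k)" "\<And>k. n k \<ge> 1" "\<And>k. R k \<ge> real k" "\<And>k. 0 < \<epsilon> k" "\<And>k. \<epsilon> k \<le> (1/2) ^ k"
    "\<And>k. \<exists>ys. ys \<noteq> [] \<and> X (Suc k) = X k @ ys"
    "\<And>k us vs z. X (Suc k) = X k @ us @ vs \<Longrightarrow> norm z \<le> R k \<Longrightarrow>
       norm (lin_prod (X k @ us) z - lin_prod (X k) z) < \<epsilon> k"
    "\<And>k z. norm z \<le> R k \<Longrightarrow> norm ((T ^^ n k) (lin_prod (X (Suc k))) z - G k z) < \<epsilon> k"
    "\<And>k. R k + real (n k) * (2 * B) \<le> R (Suc k)" "\<And>k. 2 * (2 * A) ^ n k * \<epsilon> (Suc k) = \<epsilon> k"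
proof -
  \<comment> \<open>A state is a list with a radius and a tolerance; \<open>P\<close> is the
    invariant and \<open>Q\<close> one step. The exponent \<open>n\<close> is hidden in
    \<open>Q\<close> and recovered by \<open>choice\<close>.\<close>
  define P where "P k s = (case s of (xs, R, \<epsilon>) \<Rightarrow> (0::complex) \<notin> set xs \<and> R \<ge> real k \<and> R > (0::real) \<and> 0 < \<epsilon> \<and> \<epsilon> \<le> (1/2::real) ^ k)" for k s
  define Q where "Q k s s' = (case s of (xs, R, \<epsilon>) \<Rightarrow> case s' of (xs', R', \<epsilon>') \<Rightarrow>
     \<exists>n\<ge>1. (\<exists>ys. ys \<noteq> [] \<and> xs' = xs @ ys) \<and>
       (\<forall>us vs z. xs' = xs @ us @ vs \<longrightarrow> norm z \<le> R \<longrightarrow> norm (lin_prod (xs @ us) z - lin_prod xs z) < \<epsilon>) \<and>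
       (\<forall>z. norm z \<le> R \<longrightarrow> norm ((T ^^ n) (lin_prod xs') z - G k z) < \<epsilon>) \<and>
       R + real n * (2 * B) \<le> R' \<and> 2 * (2 * A) ^ n * \<epsilon>' = \<epsilon>)" for k s s'
  have "\<exists>s. \<forall>k. P k (s k) \<and> Q k (s k) (s (Suc k))"
  proof (rule dependent_nat_choice)
    show "\<exists>s. P 0 s" by (rule exI[of _ "([], 1, 1)"]) (simp add: P_def)
    fix s k assume "P k s"
    moreover obtain xs R \<epsilon> where s: "s = (xs, R, \<epsilon>)" by (cases s)
    ultimately have s': "0 \<notin> set xs" "R \<ge> real k" "R > 0" "0 < \<epsilon>" "\<epsilon> \<le> (1/2) ^ k" by (auto simp: P_def)
    obtain ys n where ys: "n \<ge> 1" "ys \<noteq> []" "0 \<notin> set ys"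
      "\<And>us vs z. ys = us @ vs \<Longrightarrow> norm z \<le> R \<Longrightarrow> norm (lin_prod (xs @ us) z - lin_prod xs z) < \<epsilon>"
      "\<And>z. norm z \<le> R \<Longrightarrow> norm ((T ^^ n) (lin_prod (xs @ ys)) z - G k z) < \<epsilon>"
      using extend[OF G s'(3,4)] by metis
    have An: "(2 * A) ^ n \<ge> 1" using A by (intro one_le_power) simp
    define \<epsilon>' where "\<epsilon>' = \<epsilon> / (2 * (2 * A) ^ n)"
    have "\<epsilon>' \<le> \<epsilon> / (2 * 1)" unfolding \<epsilon>'_def using An s'(4) by (intro divide_left_mono) auto
    then have "\<epsilon>' \<le> (1/2) ^ Suc k" using s'(5) by simp
    moreover have "(2 * A) ^ n > 0" "A \<noteq> 0" using A by auto
    then have "\<epsilon>' > 0" "2 * (2 * A) ^ n * \<epsilon>' = \<epsilon>"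
      unfolding \<epsilon>'_def using s'(4) by (simp_all del: power_mult_distrib)
    \<comment> \<open>The summand \<open>1\<close> lets the radii tend to infinity.\<close>
    moreover have "R + 1 + real n * (2 * B) \<ge> real (Suc k)" "R + 1 + real n * (2 * B) > 0"
      using s'(2,3) B by (simp_all add: add_pos_nonneg add_increasing2)
    ultimately show "\<exists>s'. P (Suc k) s' \<and> Q k s s'"
      using ys s'(1) by (intro exI[of _ "(xs @ ys, R + 1 + real n * (2 * B), \<epsilon>')"])
        (auto simp: P_def Q_def s intro!: exI[of _ n])
  qed
  then obtain s where s: "\<And>k. P k (s k)" "\<And>k. Q k (s k) (s (Suc k))" by blast
  define X where "X k = fst (s k)" for k
  define R where "R k = fst (snd (s k))" for k
  define \<epsilon> where "\<epsilon> k = snd (snd (s k))" for k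
  have s_eq: "s k = (X k, R k, \<epsilon> k)" for k by (simp add: X_def R_def \<epsilon>_def)
  have "\<forall>k. \<exists>n\<ge>1. (\<exists>ys. ys \<noteq> [] \<and> X (Suc k) = X k @ ys) \<and>
       (\<forall>us vs z. X (Suc k) = X k @ us @ vs \<longrightarrow> norm z \<le> R k \<longrightarrow>
          norm (lin_prod (X k @ us) z - lin_prod (X k) z) < \<epsilon> k) \<and>
       (\<forall>z. norm z \<le> R k \<longrightarrow> norm ((T ^^ n) (lin_prod (X (Suc k))) z - G k z) < \<epsilon> k) \<and>
       R k + real n * (2 * B) \<le> R (Suc k) \<and> 2 * (2 * A) ^ n * \<epsilon> (Suc k) = \<epsilon> k"
    using s(2) unfolding Q_def s_eq by simp
  from choice[OF this] obtain n where n: "\<forall>k. n k \<ge> 1 \<and> (\<exists>ys. ys \<noteq> [] \<and> X (Suc k) = X k @ ys) \<and>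
       (\<forall>us vs z. X (Suc k) = X k @ us @ vs \<longrightarrow> norm z \<le> R k \<longrightarrow>
          norm (lin_prod (X k @ us) z - lin_prod (X k) z) < \<epsilon> k) \<and>
       (\<forall>z. norm z \<le> R k \<longrightarrow> norm ((T ^^ n k) (lin_prod (X (Suc k))) z - G k z) < \<epsilon> k) \<and>
       R k + real (n k) * (2 * B) \<le> R (Suc k) \<and> 2 * (2 * A) ^ n k * \<epsilon> (Suc k) = \<epsilon> k"
    by blast
  have P: "0 \<notin> set (X k)" "R k \<ge> real k" "0 < \<epsilon> k" "\<epsilon> k \<le> (1/2) ^ k" for k
    using s(1)[of k] by (auto simp: P_def s_eq)
  show ?thesis
  proof (rule that[of X n R \<epsilon>])
  qed (use n P in blast)+
qed

end

section \<open>Gluing the blocks, and density of the orbit\<close>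

context splitting_exp_coeffs
begin

lemma infinite_product_sequence:
  assumes G: "\<And>k. G k holomorphic_on UNIV"
  obtains f :: "complex \<Rightarrow> complex" and b :: "nat \<Rightarrow> complex" and n :: "nat \<Rightarrow> nat" where
    "\<And>i. b i \<noteq> 0" "f holomorphic_on UNIV" "\<And>k. n k \<ge> 1"
    "\<And>r. uniform_limit (cball 0 r) (\<lambda>J z. \<Prod>i<J. 1 - z / b i) f sequentially"
    "\<And>k z. norm z \<le> real k \<Longrightarrow> norm ((T ^^ n k) f z - G k z) < 2 * (1/2) ^ k"
proof -
  obtain X :: "nat \<Rightarrow> complex list" and n R \<epsilon> where X0: "\<And>k. 0 \<notin> set (X k)"
    and n: "\<And>k. n k \<ge> (1::nat)" and R: "\<And>k. R k \<ge> real k"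
    and \<epsilon>: "\<And>k. 0 < \<epsilon> k" "\<And>k. \<epsilon> k \<le> (1/2) ^ k"
    and ext: "\<And>k. \<exists>ys. ys \<noteq> [] \<and> X (Suc k) = X k @ ys"
    and pre: "\<And>k us vs z. X (Suc k) = X k @ us @ vs \<Longrightarrow> norm z \<le> R k \<Longrightarrow>
       norm (lin_prod (X k @ us) z - lin_prod (X k) z) < \<epsilon> k"
    and near: "\<And>k z. norm z \<le> R k \<Longrightarrow> norm ((T ^^ n k) (lin_prod (X (Suc k))) z - G k z) < \<epsilon> k"
    and Rn: "\<And>k. R k + real (n k) * (2 * B) \<le> R (Suc k)"
    and \<epsilon>n: "\<And>k. 2 * (2 * A) ^ n k * \<epsilon> (Suc k) = \<epsilon> k"
    by (rule block_sequence[where G = G, OF G]) blast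
  define len where "len k = length (X k)" for k
  have len_Suc: "len k < len (Suc k)" for k using ext[of k] by (auto simp: len_def)
  then have len_mono: "strict_mono len" by (simp add: strict_mono_Suc_iff)
  have len_ge: "k \<le> len k" for k using len_mono by (rule strict_mono_imp_increasing)
  have R_Suc: "R k \<le> R (Suc k)" for k
  proof -
    have "real (n k) * (2 * B) \<ge> 0" using B by simp
    then show ?thesis using Rn[of k] by linarith
  qed
  have \<epsilon>_half: "2 * \<epsilon> (Suc k) \<le> \<epsilon> k" for k
  proof -
    have "(2 * A) ^ n k \<ge> 1" using A by (intro one_le_power) simp
    then have "2 * 1 * \<epsilon> (Suc k) \<le> 2 * (2 * A) ^ n k * \<epsilon> (Suc k)"
      using \<epsilon>(1)[of "Suc k"] by (intro mult_right_mono mult_left_mono) auto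
    then show ?thesis using \<epsilon>n[of k] by simp
  qed
  \<comment> \<open>Entry \<open>i\<close> exists in \<open>X (Suc i)\<close> because every block is
    nonempty, and all later lists keep it.\<close>
  define b where "b i = X (Suc i) ! i" for i
  have prefix: "k \<le> m \<Longrightarrow> \<exists>zs. X m = X k @ zs" for k m
  proof (induction m rule: dec_induct)
    case (step m)
    then show ?case using ext[of m] by (metis append_assoc)
  qed simp
  have nth_b: "X k ! i = b i" if "i < len k" for i k
  proof -
    obtain zs zs' where zs: "X (max k (Suc i)) = X k @ zs" "X (max k (Suc i)) = X (Suc i) @ zs'"
      using prefix[of k "max k (Suc i)"] prefix[of "Suc i" "max k (Suc i)"] by auto
    have "i < length (X (Suc i))" using len_ge[of "Suc i"] by (simp add: len_def)
    then have "X (max k (Suc i)) ! i = X (Suc i) ! i" by (simp add: zs(2) nth_append)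
    moreover have "X (max k (Suc i)) ! i = X k ! i" using that by (simp add: zs(1) nth_append len_def)
    ultimately have "X k ! i = X (Suc i) ! i" by simp
    then show ?thesis by (simp add: b_def)
  qed
  have b0: "b i \<noteq> 0" for i
  proof -
    have "b i \<in> set (X (Suc i))" using len_ge[of "Suc i"] by (auto simp: b_def len_def intro!: nth_mem)
    then show ?thesis using X0 by metis
  qed
  define PP where "PP J z = (\<Prod>i<J. 1 - z / b i)" for J z
  have PP: "PP J = lin_prod (take J (X k))" if "J \<le> len k" for J k
  proof
    fix z
    have "lin_prod (take J (X k)) z = (\<Prod>i<J. 1 - z / (take J (X k) ! i))"
      using that by (simp add: lin_prod_def prod.list_conv_set_nth len_def atLeast0LessThan)
    also have "\<dots> = PP J z"
      unfolding PP_def using nth_b that by (intro prod.cong) auto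
    finally show "PP J z = lin_prod (take J (X k)) z" by simp
  qed
  have PP_len: "PP (len k) = lin_prod (X k)" for k using PP[of "len k" k] by (simp add: len_def)
  have block: "norm (PP J z - PP (len k) z) < \<epsilon> k"
    if J: "len k \<le> J" "J \<le> len (Suc k)" and z: "norm z \<le> R k" for J k z
  proof -
    obtain ys where ys: "X (Suc k) = X k @ ys" using ext by blast
    define us where "us = take (J - len k) ys"
    have "X (Suc k) = X k @ us @ drop (J - len k) ys" by (simp add: us_def ys)
    then have "norm (lin_prod (X k @ us) z - lin_prod (X k) z) < \<epsilon> k" using z by (rule pre)
    moreover have "PP J = lin_prod (X k @ us)"
      using PP[OF J(2)] J(1) by (simp add: ys us_def len_def)
    ultimately show ?thesis by (simp only: PP_len)
  qed
  \<comment> \<open>A telescoping sum: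
    \<open>\<epsilon> m \<le> 2 * (\<epsilon> m - \<epsilon> (Suc m))\<close> because tolerances
    halve. The second conjunct is what the next block estimate needs.\<close>
  have ends: "norm (PP (len m) z - PP (len k) z) \<le> 2 * (\<epsilon> k - \<epsilon> m) \<and> norm z \<le> R m"
    if "k \<le> m" and z: "norm z \<le> R k" for k m z
    using that(1)
  proof (induction m rule: dec_induct)
    case (step m)
    then have "norm (PP (len (Suc m)) z - PP (len m) z) < \<epsilon> m"
      using len_Suc[of m] by (intro block) auto
    then show ?case
      using step.IH \<epsilon>_half[of m] R_Suc[of m]
        norm_triangle_ineq[of "PP (len (Suc m)) z - PP (len m) z" "PP (len m) z - PP (len k) z"] by simp
  qed (use z in simp)
  \<comment> \<open>Compare with the last block end not beyond \<open>J\<close>; the term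
    \<open>- 2 * \<epsilon> m\<close> in \<open>ends\<close> pays for the incomplete block.\<close>
  have tail: "norm (PP J z - PP (len k) z) \<le> 2 * \<epsilon> k" if J: "len k \<le> J" and z: "norm z \<le> R k" for J k z
  proof -
    have fin: "finite {m. len m \<le> J}"
      by (rule finite_subset[of _ "{..J}"]) (use len_ge order_trans in auto)
    define m where "m = Max {m. len m \<le> J}"
    have "m \<in> {m. len m \<le> J}" unfolding m_def using fin J by (intro Max_in) auto
    then have m1: "len m \<le> J" by simp
    have km: "k \<le> m" unfolding m_def using fin J by (intro Max_ge) auto
    have m2: "J \<le> len (Suc m)"
    proof (rule ccontr)
      assume "\<not> J \<le> len (Suc m)"
      then have "Suc m \<le> m" unfolding m_def[of] using fin by (intro Max_ge) auto
      then show False by simp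
    qed
    have e: "norm (PP (len m) z - PP (len k) z) \<le> 2 * (\<epsilon> k - \<epsilon> m)" "norm z \<le> R m"
      using ends[OF km z] by auto
    show ?thesis
      using block[OF m1 m2 e(2)] e(1) \<epsilon>(1)[of m]
        norm_triangle_ineq[of "PP J z - PP (len m) z" "PP (len m) z - PP (len k) z"] by simp
  qed
  have Cauchy: "uniformly_Cauchy_on (cball 0 r) PP" for r
    unfolding uniformly_Cauchy_on_def
  proof (intro allI impI)
    fix e :: real assume e: "e > 0"
    have "(\<lambda>k. 4 * (1/2) ^ k :: real) \<longlonglongrightarrow> 4 * 0"
      by (intro tendsto_mult tendsto_const LIMSEQ_realpow_zero) auto
    then have "\<forall>\<^sub>F k in sequentially. 4 * (1/2) ^ k < e"
      using order_tendstoD(2)[of _ "4 * 0" sequentially e] e by simp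
    then have "\<forall>\<^sub>F k in sequentially. 4 * (1/2) ^ k < e \<and> k \<ge> nat \<lceil>r\<rceil>"
      by (intro eventually_conj eventually_ge_at_top)
    then obtain k where k: "4 * (1/2) ^ k < e" "k \<ge> nat \<lceil>r\<rceil>"
      by (auto simp: eventually_sequentially)
    have rR: "r \<le> R k" using k(2) R[of k] by linarith
    have "dist (PP m x) (PP m' x) < e" if "x \<in> cball 0 r" "m \<ge> len k" "m' \<ge> len k" for x m m'
    proof -
      have x: "norm x \<le> R k" using that(1) rR by simp
      have "dist (PP m x) (PP m' x) \<le> 2 * \<epsilon> k + 2 * \<epsilon> k"
        using tail[OF that(2) x] tail[OF that(3) x]
        by (intro order_trans[OF dist_triangle[of _ _ "PP (len k) x"]] add_mono)
          (simp_all add: dist_norm norm_minus_commute)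
      then show ?thesis using k(1) \<epsilon>(2)[of k] by simp
    qed
    then show "\<exists>M. \<forall>x\<in>cball 0 r. \<forall>m\<ge>M. \<forall>n\<ge>M. dist (PP m x) (PP n x) < e" by blast
  qed
  define f where "f z = lim (\<lambda>J. PP J z)" for z
  have lim: "uniform_limit (cball 0 r) PP f sequentially" for r
    using Cauchy_uniformly_convergent[OF Cauchy[of r]]
    unfolding uniformly_convergent_uniform_limit_iff f_def .
  have hol: "f holomorphic_on UNIV"
  proof (rule holomorphic_uniform_sequence[where f = PP])
    show "PP J holomorphic_on UNIV" for J
      unfolding PP_def using b0 by (intro holomorphic_intros) auto
    fix x :: complex
    have "cball x 1 \<subseteq> cball 0 (norm x + 1)" by (simp add: cball_subset_cball_iff)
    then have "uniform_limit (cball x 1) PP f sequentially"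
      using lim uniform_limit_on_subset by blast
    then show "\<exists>d>0. cball x d \<subseteq> UNIV \<and> uniform_limit (cball x d) PP f sequentially"
      by (intro exI[of _ 1]) auto
  qed simp
  have f_near: "norm (f z - lin_prod (X k) z) \<le> 2 * \<epsilon> k" if z: "norm z \<le> R k" for k z
  proof -
    have "(\<lambda>J. PP J z) \<longlonglongrightarrow> f z"
      by (rule tendsto_uniform_limitI[OF lim[of "norm z"]]) simp
    then have "(\<lambda>J. norm (PP J z - PP (len k) z)) \<longlonglongrightarrow> norm (f z - PP (len k) z)"
      by (intro tendsto_intros)
    then have "norm (f z - PP (len k) z) \<le> 2 * \<epsilon> k"
      by (rule LIMSEQ_le_const2) (use tail[OF _ z] in blast)
    then show ?thesis by (simp only: PP_len)
  qed
  have final: "norm ((T ^^ n k) f z - G k z) < 2 * (1/2) ^ k" if "norm z \<le> real k" for k z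
  proof -
    have z: "norm z \<le> R k" using that R[of k] by linarith
    \<comment> \<open>\<open>f_near\<close> is used at \<open>Suc k\<close>: its disc of radius
      \<open>R (Suc k)\<close> contains the enlarged disc that \<open>T_pow_diff_bound\<close> asks
      for.\<close>
    have "norm ((T ^^ n k) f z - (T ^^ n k) (lin_prod (X (Suc k))) z) \<le> (2 * A) ^ n k * (2 * \<epsilon> (Suc k))"
      using Rn[of k] by (intro T_pow_diff_bound[OF hol lin_prod_holomorphic _ z] f_near) linarith
    also have "\<dots> = \<epsilon> k" using \<epsilon>n[of k] by simp
    finally have "norm ((T ^^ n k) f z - G k z) < 2 * \<epsilon> k"
      using near[OF z] norm_triangle_ineq[of "(T ^^ n k) f z - (T ^^ n k) (lin_prod (X (Suc k))) z"
          "(T ^^ n k) (lin_prod (X (Suc k))) z - G k z"] by simp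
    then show ?thesis using \<epsilon>(2)[of k] by linarith
  qed
  show ?thesis
    by (rule that[of b f n]) (use b0 hol n final lim in \<open>auto simp: PP_def[abs_def]\<close>)
qed

lemma hypercyclic_product:
  obtains f :: "complex \<Rightarrow> complex" and b :: "nat \<Rightarrow> complex" where
    "\<And>i. b i \<noteq> 0" "f holomorphic_on UNIV" "hypercyclic HC T f"
    "limitin HC (\<lambda>J z. \<Prod>i<J. 1 - z / b i) f sequentially"
proof -
  obtain D :: "nat \<Rightarrow> complex poly" where D:
    "\<And>u r e. u holomorphic_on UNIV \<Longrightarrow> e > 0 \<Longrightarrow> \<exists>i. \<forall>z. norm z \<le> r \<longrightarrow> norm (poly (D i) z - u z) < e"
    by (rule countable_dense_in_entire) blast
  obtain f b n where b: "\<And>i. b i \<noteq> 0" and f: "f holomorphic_on UNIV" and n: "\<And>k. n k \<ge> (1::nat)"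
    and lim: "\<And>r. uniform_limit (cball 0 r) (\<lambda>J z. \<Prod>i<J. 1 - z / b i) f sequentially"
    and near: "\<And>k z. norm z \<le> real k \<Longrightarrow>
      norm ((T ^^ n k) f z - poly (D (fst (prod_decode k))) z) < 2 * (1/2) ^ k"
    using infinite_product_sequence[of "\<lambda>k. poly (D (fst (prod_decode k)))"] poly_holomorphic by metis
  have "u \<in> HC closure_of {(T ^^ n) f | n. n \<ge> 1}" if u: "u \<in> topspace HC" for u
    unfolding in_closure_of
  proof (intro conjI allI impI u)
    fix W assume W: "u \<in> W \<and> openin HC W"
    then obtain K e where K: "compact K" "e > 0"
      "{g. g holomorphic_on UNIV \<and> (\<forall>z\<in>K. dist (g z) (u z) < e)} \<subseteq> W"
      unfolding openin_HC by blast
    obtain r where r: "K \<subseteq> cball 0 r"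
      using compact_imp_bounded[OF K(1)] by (auto simp: bounded_iff subset_iff)
    have "u holomorphic_on UNIV" using u by (simp add: topspace_HC)
    then obtain i where i: "\<And>z. norm z \<le> r \<Longrightarrow> norm (poly (D i) z - u z) < e / 2"
      using D[of u "e / 2" r] K(2) by auto
    obtain m0 :: nat where m0: "(1/2) ^ m0 < e / 4"
      using real_arch_pow_inv[of "e / 4" "1/2"] K(2) by auto
    define m where "m = max m0 (nat \<lceil>r\<rceil>)"
    \<comment> \<open>Decoding pairs makes every \<open>D i\<close> a target at arbitrarily late
      stages. Here \<open>k \<ge> m\<close> yields both a large enough disc and a small enough
      error.\<close>
    define k where "k = prod_encode (i, m)"
    have km: "m \<le> k" unfolding k_def by (rule le_prod_encode_2)
    have "dist ((T ^^ n k) f z) (u z) < e" if "z \<in> K" for z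
    proof -
      have zr: "norm z \<le> r" using that r by auto
      then have "norm z \<le> real m" by (auto simp: m_def le_max_iff_disj) linarith
      then have "norm z \<le> real k" using km by linarith
      then have "norm ((T ^^ n k) f z - poly (D i) z) < 2 * (1/2) ^ k"
        using near[of z k] by (simp add: k_def)
      also have "\<dots> \<le> 2 * (1/2) ^ m0"
        using km by (intro mult_left_mono power_decreasing) (auto simp: m_def)
      also have "\<dots> < e / 2" using m0 by simp
      finally show ?thesis
        using i[OF zr] norm_triangle_ineq[of "(T ^^ n k) f z - poly (D i) z" "poly (D i) z - u z"]
        by (simp add: dist_norm)
    qed
    then have "(T ^^ n k) f \<in> W" using K(3) T_pow_holomorphic[OF f] by blast
    then show "\<exists>y. y \<in> {(T ^^ n) f | n. n \<ge> 1} \<and> y \<in> W" using n[of k] by blast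
  qed
  then have "HC closure_of {(T ^^ n) f | n. n \<ge> 1} = topspace HC"
    using closure_of_subset_topspace by fastforce
  then have "hypercyclic HC T f" using f by (simp add: hypercyclic_def topspace_HC)
  moreover have "limitin HC (\<lambda>J z. \<Prod>i<J. 1 - z / b i) f sequentially"
    unfolding limitin_HC
  proof (intro conjI allI impI f always_eventually)
    show "(\<lambda>z. \<Prod>i<J. 1 - z / b i) holomorphic_on UNIV" for J
      using b by (intro holomorphic_intros) auto
    fix K :: "complex set" assume K: "compact K"
    obtain r where "K \<subseteq> cball 0 r"
      using compact_imp_bounded[OF K] by (auto simp: bounded_iff subset_iff)
    then show "uniform_limit K (\<lambda>J z. \<Prod>i<J. 1 - z / b i) f sequentially"
      using lim uniform_limit_on_subset by blast
  qed
  ultimately show ?thesis using that b f by blast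
qed

end

section \<open>Entire functions of exponential type\<close>

text \<open>Cauchy's inequality on the circle of radius \<open>j\<close>, combined with
  \<open>fact j \<le> j ^ j\<close>. The radius has to be positive, so \<open>j = 0\<close> is
  treated separately; \<open>A + 1\<close> ensures the lower bound \<open>1\<close>.\<close>

lemma exponential_type_coeff_bound:
  assumes hol: "\<phi> holomorphic_on UNIV" and "exponential_type \<phi>"
  obtains A B where "A \<ge> 1" "B > 0" "\<And>j. norm (fps_nth (fps_expansion \<phi> 0) j) \<le> A * B ^ j / fact j"
proof -
  obtain A B where AB: "A \<ge> 0" "B \<ge> 0" "\<And>z. norm (\<phi> z) \<le> A * exp (B * norm z)"
    using assms(2) unfolding exponential_type_def by blast
  have "norm (fps_nth (fps_expansion \<phi> 0) j) \<le> (A + 1) * exp B ^ j / fact j" for j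
  proof (cases "j = 0")
    case True
    then show ?thesis using AB(3)[of 0] by (simp add: fps_expansion_def)
  next
    case False
    have "norm ((deriv ^^ j) \<phi> 0) \<le> fact j * (A * exp (B * real j)) / real j ^ j"
    proof (rule Cauchy_inequality)
      show "norm (\<phi> x) \<le> A * exp (B * real j)" if "norm (0 - x) = real j" for x
        using AB(3)[of x] that by simp
    qed (use False in \<open>auto intro: holomorphic_on_subset[OF hol]
        continuous_on_subset[OF holomorphic_on_imp_continuous_on[OF hol]]\<close>)
    then have "norm ((deriv ^^ j) \<phi> 0 / fact j) \<le> A * exp (B * real j) / real j ^ j"
      by (simp add: norm_divide field_simps)
    also have "\<dots> \<le> (A + 1) * exp (B * real j) / fact j"
      using AB(1) fact_le_power[of j, where 'a = real] by (intro frac_le mult_right_mono) auto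
    also have "exp (B * real j) = exp B ^ j" by (simp only: exp_of_nat_mult mult.commute[of B])
    finally show ?thesis by (simp add: fps_expansion_def)
  qed
  then show ?thesis using that[of "A + 1" "exp B"] AB(1) by auto
qed

text \<open>Otherwise \<open>1 / \<phi>\<close> is entire and bounded.\<close>

lemma exists_norm_less_one:
  assumes hol: "\<phi> holomorphic_on UNIV" and nc: "\<not> \<phi> constant_on UNIV"
  shows "\<exists>l. norm (\<phi> l) < 1"
proof (rule ccontr)
  assume "\<not> ?thesis"
  then have ge: "norm (\<phi> l) \<ge> 1" for l by (meson not_less)
  then have nz: "\<phi> l \<noteq> 0" for l by (metis norm_zero not_one_le_zero)
  have "(\<lambda>l. inverse (\<phi> l)) constant_on UNIV"
  proof (rule Liouville_theorem)
    show "(\<lambda>l. inverse (\<phi> l)) holomorphic_on UNIV"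
      using hol nz by (intro holomorphic_intros) auto
    show "bounded (range (\<lambda>l. inverse (\<phi> l)))"
      unfolding bounded_iff using ge nz
      by (intro exI[of _ 1]) (auto simp: norm_inverse inverse_le_1_iff)
  qed
  then have "\<phi> constant_on UNIV" unfolding constant_on_def by (metis inverse_inverse_eq)
  with nc show False by simp
qed

text \<open>The open set where the modulus exceeds \<open>1\<close> is nonempty by Liouville; if the
  derivative vanished on it, it would vanish everywhere by the identity theorem.\<close>

lemma exists_norm_greater_one_deriv_nonzero:
  assumes hol: "\<phi> holomorphic_on UNIV" and nc: "\<not> \<phi> constant_on UNIV"
  shows "\<exists>l. norm (\<phi> l) > 1 \<and> deriv \<phi> l \<noteq> 0"
proof (rule ccontr)
  assume *: "\<not> ?thesis"
  define U where "U = {l. norm (\<phi> l) > 1}"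
  have cont: "continuous_on UNIV \<phi>" using hol by (rule holomorphic_on_imp_continuous_on)
  have U: "open U" unfolding U_def by (intro open_Collect_less continuous_intros cont)
  have "U \<noteq> {}"
  proof
    assume "U = {}"
    then have "bounded (range \<phi>)" unfolding bounded_iff U_def by (auto simp: not_less intro!: exI[of _ 1])
    with Liouville_theorem[OF hol] nc show False by simp
  qed
  have "deriv \<phi> z = 0" for z
    by (rule analytic_continuation_open[OF U open_UNIV \<open>U \<noteq> {}\<close> connected_UNIV])
      (use hol * in \<open>auto simp: U_def intro!: holomorphic_intros\<close>)
  then have "(\<phi> has_field_derivative 0) (at z)" for z
    using holomorphic_derivI[OF hol open_UNIV, of z] by simp
  then have "\<exists>c. \<forall>x\<in>UNIV. \<phi> x = c"
    by (intro has_field_derivative_zero_constant) auto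
  with nc show False unfolding constant_on_def by blast
qed

lemma taylor_eq:
  fixes c :: "nat \<Rightarrow> complex"
  assumes "exp_coeffs c A B" and sums: "\<And>z. (\<lambda>j. c j * z ^ j) sums \<phi> z"
  shows "exp_coeffs.taylor c l 0 = \<phi> l" "exp_coeffs.taylor c l 1 = deriv \<phi> l"
proof -
  interpret exp_coeffs c A B by fact
  show "taylor l 0 = \<phi> l" using sums_unique[OF sums[of l]] by (simp add: taylor_def)
  have \<phi>: "\<phi> = (\<lambda>z. \<Sum>j. c j * z ^ j)" using sums_unique[OF sums] by auto
  have "(\<phi> has_field_derivative (\<Sum>n. diffs c n * l ^ n)) (at l)"
    unfolding \<phi> using sums_summable[OF sums] by (rule termdiffs_strong_converges_everywhere)
  then have "deriv \<phi> l = (\<Sum>n. diffs c n * l ^ n)" by (rule DERIV_imp_deriv)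
  also have "\<dots> = (\<Sum>n. c (Suc n) * of_nat (Suc n choose 1) * l ^ (Suc n - 1))"
    by (simp add: diffs_def mult.commute)
  also have "\<dots> = taylor l 1"
    using suminf_split_head[OF summable_taylor[of 1 l]] by (simp add: taylor_def)
  finally show "taylor l 1 = deriv \<phi> l" by simp
qed

theorem theorem9:
  fixes \<phi> :: "complex \<Rightarrow> complex"
  assumes "\<phi> holomorphic_on UNIV"
    and "exponential_type \<phi>"
    and "\<not> \<phi> constant_on UNIV"
  shows "\<exists>(f :: complex \<Rightarrow> complex) (a :: nat \<Rightarrow> complex).
      f \<in> topspace HC \<and> (\<forall>j\<ge>1. a j \<noteq> 0) \<and>
      hypercyclic HC (diff_op \<phi>) f \<and>
      limitin HC (\<lambda>J z. \<Prod>j=1..J. (1 - z / a j)) f sequentially"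
proof -
  define c where "c = fps_nth (fps_expansion \<phi> 0)"
  obtain A B where AB: "A \<ge> 1" "B > 0" "\<And>j. norm (c j) \<le> A * B ^ j / fact j"
    using exponential_type_coeff_bound[OF assms(1,2)] unfolding c_def by metis
  then have coeffs: "exp_coeffs c A B" by unfold_locales auto
  have sums: "(\<lambda>j. c j * z ^ j) sums \<phi> z" for z
    using holomorphic_power_series[OF holomorphic_on_subset[OF assms(1)], of 0 "norm z + 1" z]
    by (simp add: c_def fps_expansion_def)
  note taylor = taylor_eq[OF coeffs sums]
  have cont: "continuous_on UNIV \<phi>" "continuous_on UNIV (deriv \<phi>)"
    using assms(1) by (intro holomorphic_on_imp_continuous_on holomorphic_intros; simp)+
  interpret exp_coeffs c A B by (rule coeffs)
  interpret splitting_exp_coeffs c A B "{l. norm (\<phi> l) < 1}" "{l. norm (\<phi> l) > 1} \<inter> {l. deriv \<phi> l \<noteq> 0}"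
  proof
    show "open {l. norm (\<phi> l) < 1}" by (intro open_Collect_less continuous_intros cont)
    show "open ({l. norm (\<phi> l) > 1} \<inter> {l. deriv \<phi> l \<noteq> 0})"
      by (intro open_Int open_Collect_less open_Collect_neq continuous_intros cont)
    show "{l. norm (\<phi> l) < 1} \<noteq> {}" using exists_norm_less_one[OF assms(1,3)] by auto
    show "{l. norm (\<phi> l) > 1} \<inter> {l. deriv \<phi> l \<noteq> 0} \<noteq> {}"
      using exists_norm_greater_one_deriv_nonzero[OF assms(1,3)] by auto
  qed (auto simp: taylor taylor(2)[unfolded One_nat_def])
  obtain f b where fb: "\<And>i. b i \<noteq> 0" "f holomorphic_on UNIV" "hypercyclic HC T f"
    "limitin HC (\<lambda>J z. \<Prod>i<J. 1 - z / b i) f sequentially"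
    using hypercyclic_product by metis
  have "T g z = diff_op \<phi> g z" for g z
    unfolding T_def diff_op_def by (simp add: c_def)
  then have "T = diff_op \<phi>" by blast
  \<comment> \<open>The factors are numbered from \<open>0\<close> in the construction and from
    \<open>1\<close> in the claim, hence the shift \<open>b (j - 1)\<close>.\<close>
  then show ?thesis
    using fb by (intro exI[of _ f] exI[of _ "\<lambda>j. b (j - 1)"])
      (simp add: topspace_HC prod.atLeast1_atMost_eq)
qed

end
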